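(* Let $H$ be a cocommutative Hopf algebra over a field $\Bbbk$ that is right noetherian as a ring. Then every tensor torsion class of $\mathsf{mod}\,H$ is either zero or $\mathsf{mod}\,H$. In particular, every tensor torsion class is a Serre subcategory.
   Context: $\mathsf{Mod}\,H$ is the category of right $H$-modules and $\mathsf{mod}\,H$ its full subcategory of finitely generated modules. For $M,N\in\mathsf{Mod}\,H$, the tensor product $M\otimes N:=M\otimes_{\Bbbk}N$ is an $H$-module via the coproduct $\Delta\colon H\to H\otimes_{\Bbbk}H$. Cocommutative means $\tau\circ\Delta=\Delta$, where $\tau(a\otimes b)=b\otimes a$. Subcategories are full and closed under isomorphisms. A torsion class of $\mathsf{mod}\,H$ is an additive subcategory closed under quotients and extensions; it is a tensor torsion class if moreover it is a tensor ideal, i.e. $X\otimes M\in\mathcal{X}$ for all $X\in\mathcal{X}$ and all $M\in\mathsf{mod}\,H$. A Serre subcategory is an additive subcategory closed under subobjects, quotients and extensions. *)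

theory Defs
  imports "HOL-Algebra.Free_Abelian_Groups" "HOL-Algebra.Chinese_Remainder" "HOL-Library.Equipollence"
begin

section \<open>Right modules over a not necessarily commutative ring\<close>

text \<open>As in the record \<open>module\<close> of HOL-Algebra, the fields \<open>mult\<close> and \<open>one\<close> inherited from
  \<open>ring\<close> carry no meaning.\<close>

record ('r, 'm) rmodule = "'m ring" +
  ract :: "'m \<Rightarrow> 'r \<Rightarrow> 'm" (infixl \<open>\<bullet>\<index>\<close> 70)

locale right_module = R: ring R + M: abelian_group M
  for R :: "('r, 'x) ring_scheme" and M :: "('r, 'm) rmodule" +
  assumes ract_closed: "\<lbrakk>x \<in> carrier M; r \<in> carrier R\<rbrakk> \<Longrightarrow> x \<bullet>\<^bsub>M\<^esub> r \<in> carrier M"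
    and ract_add_left: "\<lbrakk>x \<in> carrier M; y \<in> carrier M; r \<in> carrier R\<rbrakk> \<Longrightarrow>
      (x \<oplus>\<^bsub>M\<^esub> y) \<bullet>\<^bsub>M\<^esub> r = x \<bullet>\<^bsub>M\<^esub> r \<oplus>\<^bsub>M\<^esub> y \<bullet>\<^bsub>M\<^esub> r"
    and ract_add_right: "\<lbrakk>x \<in> carrier M; r \<in> carrier R; s \<in> carrier R\<rbrakk> \<Longrightarrow>
      x \<bullet>\<^bsub>M\<^esub> (r \<oplus>\<^bsub>R\<^esub> s) = x \<bullet>\<^bsub>M\<^esub> r \<oplus>\<^bsub>M\<^esub> x \<bullet>\<^bsub>M\<^esub> s"
    and ract_assoc: "\<lbrakk>x \<in> carrier M; r \<in> carrier R; s \<in> carrier R\<rbrakk> \<Longrightarrow>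
      x \<bullet>\<^bsub>M\<^esub> (r \<otimes>\<^bsub>R\<^esub> s) = x \<bullet>\<^bsub>M\<^esub> r \<bullet>\<^bsub>M\<^esub> s"
    and ract_one: "x \<in> carrier M \<Longrightarrow> x \<bullet>\<^bsub>M\<^esub> \<one>\<^bsub>R\<^esub> = x"

definition rmod_hom :: "('r, 'x) ring_scheme \<Rightarrow> ('r, 'm) rmodule \<Rightarrow> ('r, 'n) rmodule \<Rightarrow> ('m \<Rightarrow> 'n) set"
  where "rmod_hom R M N = {f \<in> hom (add_monoid M) (add_monoid N).
           \<forall>x\<in>carrier M. \<forall>r\<in>carrier R. f (x \<bullet>\<^bsub>M\<^esub> r) = f x \<bullet>\<^bsub>N\<^esub> r}"

definition rmod_isomorphic :: "('r, 'x) ring_scheme \<Rightarrow> ('r, 'm) rmodule \<Rightarrow> ('r, 'n) rmodule \<Rightarrow> bool"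
  where "rmod_isomorphic R M N \<longleftrightarrow> (\<exists>f\<in>rmod_hom R M N. bij_betw f (carrier M) (carrier N))"

definition rsubmodule :: "('r, 'x) ring_scheme \<Rightarrow> ('r, 'm) rmodule \<Rightarrow> 'm set \<Rightarrow> bool"
  where "rsubmodule R M N \<longleftrightarrow> additive_subgroup N M \<and> (\<forall>x\<in>N. \<forall>r\<in>carrier R. x \<bullet>\<^bsub>M\<^esub> r \<in> N)"

definition rspan :: "('r, 'x) ring_scheme \<Rightarrow> ('r, 'm) rmodule \<Rightarrow> 'm set \<Rightarrow> 'm set"
  where "rspan R M A = \<Inter>{N. rsubmodule R M N \<and> A \<subseteq> N}"

definition fin_gen :: "('r, 'x) ring_scheme \<Rightarrow> ('r, 'm) rmodule \<Rightarrow> bool"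
  where "fin_gen R M \<longleftrightarrow> (\<exists>A. finite A \<and> A \<subseteq> carrier M \<and> rspan R M A = carrier M)"

definition regular :: "('r, 'x) ring_scheme \<Rightarrow> ('r, 'r) rmodule"
  where "regular R = ring.extend (ring.truncate R) \<lparr>ract = monoid.mult R\<rparr>"

definition right_noetherian :: "('r, 'x) ring_scheme \<Rightarrow> bool"
  where "right_noetherian R \<longleftrightarrow>
    (\<forall>I. rsubmodule R (regular R) I \<longrightarrow> (\<exists>A. finite A \<and> A \<subseteq> I \<and> rspan R (regular R) A = I))"

definition rmod_sum :: "('r, 'm) rmodule \<Rightarrow> ('r, 'n) rmodule \<Rightarrow> ('r, 'm \<times> 'n) rmodule"
  where "rmod_sum M N =
    ring.extend (RDirProd M N) \<lparr>ract = \<lambda>p r. (fst p \<bullet>\<^bsub>M\<^esub> r, snd p \<bullet>\<^bsub>N\<^esub> r)\<rparr>"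


section \<open>Tensor products over a commutative ring\<close>

text \<open>For modules \<open>A\<close> and \<open>B\<close> over a commutative ring \<open>K\<close>, the tensor product over \<open>K\<close> is the free
  abelian group on \<open>A \<times> B\<close> modulo the usual bilinearity relations; its elements are cosets. The
  actions are written on the right throughout, also for vector spaces.\<close>

definition tensor_relations ::
    "('k, 'x) ring_scheme \<Rightarrow> ('k, 'a) rmodule \<Rightarrow> ('k, 'b) rmodule \<Rightarrow> ('a \<times> 'b \<Rightarrow>\<^sub>0 int) set"
  where "tensor_relations K A B =
      {frag_of (a \<oplus>\<^bsub>A\<^esub> a', b) - frag_of (a, b) - frag_of (a', b) | a a' b.
         a \<in> carrier A \<and> a' \<in> carrier A \<and> b \<in> carrier B}
    \<union> {frag_of (a, b \<oplus>\<^bsub>B\<^esub> b') - frag_of (a, b) - frag_of (a, b') | a b b'.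
         a \<in> carrier A \<and> b \<in> carrier B \<and> b' \<in> carrier B}
    \<union> {frag_of (a \<bullet>\<^bsub>A\<^esub> c, b) - frag_of (a, b \<bullet>\<^bsub>B\<^esub> c) | a b c.
         a \<in> carrier A \<and> b \<in> carrier B \<and> c \<in> carrier K}"

definition tensor_kernel ::
    "('k, 'x) ring_scheme \<Rightarrow> ('k, 'a) rmodule \<Rightarrow> ('k, 'b) rmodule \<Rightarrow> ('a \<times> 'b \<Rightarrow>\<^sub>0 int) set"
  where "tensor_kernel K A B =
    generate (free_Abelian_group (carrier A \<times> carrier B)) (tensor_relations K A B)"

definition tensor_group ::
    "('k, 'x) ring_scheme \<Rightarrow> ('k, 'a) rmodule \<Rightarrow> ('k, 'b) rmodule \<Rightarrow> ('a \<times> 'b \<Rightarrow>\<^sub>0 int) set ring"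
  where "tensor_group K A B =
    (let Q = free_Abelian_group (carrier A \<times> carrier B) Mod tensor_kernel K A B
     in \<lparr>carrier = carrier Q, monoid.mult = undefined, one = undefined,
           ring.zero = one Q, ring.add = monoid.mult Q\<rparr>)"

definition pure :: "('k, 'x) ring_scheme \<Rightarrow> ('k, 'a) rmodule \<Rightarrow> ('k, 'b) rmodule \<Rightarrow>
    'a \<Rightarrow> 'b \<Rightarrow> ('a \<times> 'b \<Rightarrow>\<^sub>0 int) set"
  where "pure K A B a b =
    tensor_kernel K A B #>\<^bsub>free_Abelian_group (carrier A \<times> carrier B)\<^esub> frag_of (a, b)"

definition frag_eval :: "('g, 'x) ring_scheme \<Rightarrow> ('a \<Rightarrow> 'b \<Rightarrow> 'g) \<Rightarrow> ('a \<times> 'b \<Rightarrow>\<^sub>0 int) \<Rightarrow> 'g"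
  where "frag_eval G \<phi> t =
    (\<Oplus>\<^bsub>G\<^esub>p\<in>Poly_Mapping.keys t. add_pow G (Poly_Mapping.lookup t p) (\<phi> (fst p) (snd p)))"

text \<open>The additive map \<open>A \<otimes> B \<rightarrow> G\<close> with \<open>a \<otimes> b \<mapsto> \<phi> a b\<close>, evaluated at the coset \<open>T\<close> by means of
  an arbitrary representative of \<open>T\<close>. It is only ever used for \<open>K\<close>-balanced biadditive \<open>\<phi>\<close>, for
  which the value does not depend on the representative; see \<open>lift_eq\<close> below.\<close>

definition tensor_lift :: "('g, 'x) ring_scheme \<Rightarrow> ('a \<Rightarrow> 'b \<Rightarrow> 'g) \<Rightarrow> ('a \<times> 'b \<Rightarrow>\<^sub>0 int) set \<Rightarrow> 'g"
  where "tensor_lift G \<phi> T = frag_eval G \<phi> (SOME t. t \<in> T)"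

definition tensor ::
    "('k, 'x) ring_scheme \<Rightarrow> ('k, 'a) rmodule \<Rightarrow> ('k, 'b) rmodule \<Rightarrow> ('k, ('a \<times> 'b \<Rightarrow>\<^sub>0 int) set) rmodule"
  where "tensor K A B = ring.extend (tensor_group K A B)
    \<lparr>ract = \<lambda>T c. tensor_lift (tensor_group K A B) (\<lambda>a b. pure K A B (a \<bullet>\<^bsub>A\<^esub> c) b) T\<rparr>"

definition tensor_map :: "('k, 'x) ring_scheme \<Rightarrow> ('k, 'c) rmodule \<Rightarrow> ('k, 'd) rmodule \<Rightarrow>
    ('a \<Rightarrow> 'c) \<Rightarrow> ('b \<Rightarrow> 'd) \<Rightarrow> ('a \<times> 'b \<Rightarrow>\<^sub>0 int) set \<Rightarrow> ('c \<times> 'd \<Rightarrow>\<^sub>0 int) set"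
  where "tensor_map K C D f g = tensor_lift (tensor K C D) (\<lambda>a b. pure K C D (f a) (g b))"

definition tensor_swap :: "('k, 'x) ring_scheme \<Rightarrow> ('k, 'a) rmodule \<Rightarrow> ('k, 'b) rmodule \<Rightarrow>
    ('a \<times> 'b \<Rightarrow>\<^sub>0 int) set \<Rightarrow> ('b \<times> 'a \<Rightarrow>\<^sub>0 int) set"
  where "tensor_swap K A B = tensor_lift (tensor K B A) (\<lambda>a b. pure K B A b a)"

definition tensor_assoc ::
    "('k, 'x) ring_scheme \<Rightarrow> ('k, 'a) rmodule \<Rightarrow> ('k, 'b) rmodule \<Rightarrow> ('k, 'c) rmodule \<Rightarrow>
      (('a \<times> 'b \<Rightarrow>\<^sub>0 int) set \<times> 'c \<Rightarrow>\<^sub>0 int) set \<Rightarrow> ('a \<times> ('b \<times> 'c \<Rightarrow>\<^sub>0 int) set \<Rightarrow>\<^sub>0 int) set"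
  where "tensor_assoc K A B C =
    tensor_lift (tensor K A (tensor K B C)) (\<lambda>t c.
      tensor_lift (tensor K A (tensor K B C)) (\<lambda>a b. pure K A (tensor K B C) a (pure K B C b c)) t)"


section \<open>Hopf algebras\<close>

record ('k, 'h) hopf = "'h ring" +
  unit_map :: "'k \<Rightarrow> 'h"
  comult :: "'h \<Rightarrow> ('h \<times> 'h \<Rightarrow>\<^sub>0 int) set"
  counit :: "'h \<Rightarrow> 'k"
  antipode :: "'h \<Rightarrow> 'h"

text \<open>The \<open>K\<close>-module underlying an \<open>H\<close>-module, where \<open>H\<close> is a \<open>K\<close>-algebra.\<close>

definition restrict_scalars :: "('k, 'h) hopf \<Rightarrow> ('h, 'm) rmodule \<Rightarrow> ('k, 'm) rmodule"
  where "restrict_scalars H M =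
    ring.extend (ring.truncate M) \<lparr>ract = \<lambda>x c. x \<bullet>\<^bsub>M\<^esub> unit_map H c\<rparr>"

definition hspace :: "('k, 'h) hopf \<Rightarrow> ('k, 'h) rmodule"
  where "hspace H = restrict_scalars H (regular H)"

abbreviation hopf_square ::
    "('k, 'x) ring_scheme \<Rightarrow> ('k, 'h) hopf \<Rightarrow> ('k, ('h \<times> 'h \<Rightarrow>\<^sub>0 int) set) rmodule"
  where "hopf_square K H \<equiv> tensor K (hspace H) (hspace H)"

definition hopf_square_mult :: "('k, 'x) ring_scheme \<Rightarrow> ('k, 'h) hopf \<Rightarrow>
    ('h \<times> 'h \<Rightarrow>\<^sub>0 int) set \<Rightarrow> ('h \<times> 'h \<Rightarrow>\<^sub>0 int) set \<Rightarrow> ('h \<times> 'h \<Rightarrow>\<^sub>0 int) set"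
  where "hopf_square_mult K H s t =
    tensor_lift (hopf_square K H) (\<lambda>a b.
      tensor_lift (hopf_square K H) (\<lambda>c d.
        pure K (hspace H) (hspace H) (a \<otimes>\<^bsub>H\<^esub> c) (b \<otimes>\<^bsub>H\<^esub> d)) t) s"

text \<open>The algebra structure is given by a ring homomorphism \<open>unit_map H\<close> from \<open>K\<close> to the centre of
  \<open>H\<close>. In the counit axioms \<open>K \<otimes> H\<close> and \<open>H \<otimes> K\<close> are identified with \<open>H\<close>.\<close>

locale hopf_algebra = K: field K + H: ring H
  for K :: "('k, 'x) ring_scheme" and H :: "('k, 'h) hopf" +
  assumes unit_map_hom: "unit_map H \<in> ring_hom K H"
    and unit_map_central: "\<lbrakk>c \<in> carrier K; h \<in> carrier H\<rbrakk> \<Longrightarrow>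
      unit_map H c \<otimes>\<^bsub>H\<^esub> h = h \<otimes>\<^bsub>H\<^esub> unit_map H c"
    \<comment> \<open>\<open>comult H\<close> is a homomorphism of \<open>K\<close>-algebras\<close>
    and comult_linear: "comult H \<in> rmod_hom K (hspace H) (hopf_square K H)"
    and comult_mult: "\<lbrakk>g \<in> carrier H; h \<in> carrier H\<rbrakk> \<Longrightarrow>
      comult H (g \<otimes>\<^bsub>H\<^esub> h) = hopf_square_mult K H (comult H g) (comult H h)"
    and comult_one: "comult H \<one>\<^bsub>H\<^esub> = pure K (hspace H) (hspace H) \<one>\<^bsub>H\<^esub> \<one>\<^bsub>H\<^esub>"
    \<comment> \<open>\<open>counit H\<close> is a homomorphism of \<open>K\<close>-algebras\<close>
    and counit_hom: "counit H \<in> ring_hom H K"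
    and counit_unit_map: "c \<in> carrier K \<Longrightarrow> counit H (unit_map H c) = c"
    \<comment> \<open>coassociativity, counit and antipode axioms\<close>
    and coassoc: "h \<in> carrier H \<Longrightarrow>
      tensor_assoc K (hspace H) (hspace H) (hspace H)
        (tensor_map K (hopf_square K H) (hspace H) (comult H) (\<lambda>a. a) (comult H h)) =
      tensor_map K (hspace H) (hopf_square K H) (\<lambda>a. a) (comult H) (comult H h)"
    and counit_left: "h \<in> carrier H \<Longrightarrow>
      tensor_lift H (\<lambda>a b. unit_map H (counit H a) \<otimes>\<^bsub>H\<^esub> b) (comult H h) = h"
    and counit_right: "h \<in> carrier H \<Longrightarrow>
      tensor_lift H (\<lambda>a b. a \<otimes>\<^bsub>H\<^esub> unit_map H (counit H b)) (comult H h) = h"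
    and antipode_linear: "antipode H \<in> rmod_hom K (hspace H) (hspace H)"
    and antipode_left: "h \<in> carrier H \<Longrightarrow>
      tensor_lift H (\<lambda>a b. antipode H a \<otimes>\<^bsub>H\<^esub> b) (comult H h) = unit_map H (counit H h)"
    and antipode_right: "h \<in> carrier H \<Longrightarrow>
      tensor_lift H (\<lambda>a b. a \<otimes>\<^bsub>H\<^esub> antipode H b) (comult H h) = unit_map H (counit H h)"

definition cocommutative :: "('k, 'x) ring_scheme \<Rightarrow> ('k, 'h) hopf \<Rightarrow> bool"
  where "cocommutative K H \<longleftrightarrow>
    (\<forall>h\<in>carrier H. tensor_swap K (hspace H) (hspace H) (comult H h) = comult H h)"

text \<open>The \<open>H\<close>-module \<open>M \<otimes> N\<close> over the field \<open>K\<close>, with \<open>(x \<otimes> y) h = \<Sum> x a \<otimes> y b\<close> if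
  \<open>comult H h = \<Sum> a \<otimes> b\<close>.\<close>

definition tensor_module :: "('k, 'x) ring_scheme \<Rightarrow> ('k, 'h) hopf \<Rightarrow>
    ('h, 'm) rmodule \<Rightarrow> ('h, 'n) rmodule \<Rightarrow> ('h, ('m \<times> 'n \<Rightarrow>\<^sub>0 int) set) rmodule"
  where "tensor_module K H M N =
    (let M' = restrict_scalars H M; N' = restrict_scalars H N; G = tensor_group K M' N'
     in ring.extend G \<lparr>ract = \<lambda>T h.
          tensor_lift G (\<lambda>x y.
            tensor_lift G (\<lambda>a b. pure K M' N' (x \<bullet>\<^bsub>M\<^esub> a) (y \<bullet>\<^bsub>N\<^esub> b)) (comult H h)) T\<rparr>)"


section \<open>Subcategories of finitely generated modules\<close>

text \<open>Modules are carried by subsets of a type \<open>'u\<close>. When \<open>'u\<close> is large enough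
  (\<open>lists (carrier R) \<lesssim> UNIV\<close>), every finitely generated right \<open>R\<close>-module, on whatever type, is
  isomorphic to one carried by \<open>'u\<close>; see \<open>fin_gen_copy\<close> below. A full subcategory closed under
  isomorphisms is given by its set of objects.\<close>

definition fmod :: "('r, 'x) ring_scheme \<Rightarrow> ('r, 'u) rmodule set"
  where "fmod R = {M. right_module R M \<and> fin_gen R M}"

text \<open>Membership of a module that need not be carried by \<open>'u\<close>.\<close>

definition belongs_to ::
    "('r, 'x) ring_scheme \<Rightarrow> ('r, 'm) rmodule \<Rightarrow> ('r, 'u) rmodule set \<Rightarrow> bool"
  where "belongs_to R M \<X> \<longleftrightarrow> (\<exists>X\<in>\<X>. rmod_isomorphic R X M)"

definition zero_subcategory :: "('r, 'x) ring_scheme \<Rightarrow> ('r, 'u) rmodule set"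
  where "zero_subcategory R = {M \<in> fmod R. carrier M = {\<zero>\<^bsub>M\<^esub>}}"

definition additive_subcategory :: "('r, 'x) ring_scheme \<Rightarrow> ('r, 'u) rmodule set \<Rightarrow> bool"
  where "additive_subcategory R \<X> \<longleftrightarrow>
    \<X> \<subseteq> fmod R \<and>
    (\<forall>X\<in>\<X>. \<forall>Y\<in>fmod R. rmod_isomorphic R X Y \<longrightarrow> Y \<in> \<X>) \<and>
    zero_subcategory R \<subseteq> \<X> \<and>
    (\<forall>X\<in>\<X>. \<forall>Y\<in>\<X>. belongs_to R (rmod_sum X Y) \<X>)"

definition closed_under_quotients :: "('r, 'x) ring_scheme \<Rightarrow> ('r, 'u) rmodule set \<Rightarrow> bool"
  where "closed_under_quotients R \<X> \<longleftrightarrow>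
    (\<forall>X\<in>\<X>. \<forall>M\<in>fmod R. \<forall>f\<in>rmod_hom R X M. f ` carrier X = carrier M \<longrightarrow> M \<in> \<X>)"

definition closed_under_subobjects :: "('r, 'x) ring_scheme \<Rightarrow> ('r, 'u) rmodule set \<Rightarrow> bool"
  where "closed_under_subobjects R \<X> \<longleftrightarrow>
    (\<forall>X\<in>\<X>. \<forall>M\<in>fmod R. \<forall>f\<in>rmod_hom R M X. inj_on f (carrier M) \<longrightarrow> M \<in> \<X>)"

text \<open>Extensions are short exact sequences \<open>0 \<rightarrow> X \<rightarrow> M \<rightarrow> Y \<rightarrow> 0\<close>.\<close>

definition closed_under_extensions :: "('r, 'x) ring_scheme \<Rightarrow> ('r, 'u) rmodule set \<Rightarrow> bool"
  where "closed_under_extensions R \<X> \<longleftrightarrow>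
    (\<forall>X\<in>\<X>. \<forall>Y\<in>\<X>. \<forall>M\<in>fmod R. \<forall>f\<in>rmod_hom R X M. \<forall>g\<in>rmod_hom R M Y.
       inj_on f (carrier X) \<and> f ` carrier X = a_kernel M Y g \<and> g ` carrier M = carrier Y \<longrightarrow> M \<in> \<X>)"

definition torsion_class :: "('r, 'x) ring_scheme \<Rightarrow> ('r, 'u) rmodule set \<Rightarrow> bool"
  where "torsion_class R \<X> \<longleftrightarrow>
    additive_subcategory R \<X> \<and> closed_under_quotients R \<X> \<and> closed_under_extensions R \<X>"

definition serre_subcategory :: "('r, 'x) ring_scheme \<Rightarrow> ('r, 'u) rmodule set \<Rightarrow> bool"
  where "serre_subcategory R \<X> \<longleftrightarrow>
    additive_subcategory R \<X> \<and> closed_under_subobjects R \<X> \<and>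
    closed_under_quotients R \<X> \<and> closed_under_extensions R \<X>"

definition tensor_ideal ::
    "('k, 'x) ring_scheme \<Rightarrow> ('k, 'h) hopf \<Rightarrow> ('h, 'u) rmodule set \<Rightarrow> bool"
  where "tensor_ideal K H \<X> \<longleftrightarrow>
    (\<forall>X\<in>\<X>. \<forall>M\<in>(fmod H :: ('h, 'u) rmodule set). belongs_to H (tensor_module K H X M) \<X>)"

definition tensor_torsion_class ::
    "('k, 'x) ring_scheme \<Rightarrow> ('k, 'h) hopf \<Rightarrow> ('h, 'u) rmodule set \<Rightarrow> bool"
  where "tensor_torsion_class K H \<X> \<longleftrightarrow> torsion_class H \<X> \<and> tensor_ideal K H \<X>"


section \<open>Well-definedness of \<open>tensor_lift\<close>\<close>

lemma (in abelian_group) frag_eval_superset: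
  assumes "\<And>a b. (a, b) \<in> S \<Longrightarrow> \<phi> a b \<in> carrier G" and "finite W" "W \<subseteq> S" "Poly_Mapping.keys t \<subseteq> W"
  shows "frag_eval G \<phi> t = (\<Oplus>p\<in>W. add_pow G (Poly_Mapping.lookup t p) (\<phi> (fst p) (snd p)))"
  unfolding frag_eval_def
  by (rule add.finprod_mono_neutral_cong_left[unfolded finsum_def[symmetric]])
    (use assms in \<open>auto simp: subset_iff in_keys_iff add_pow_def intro!: add.int_pow_closed[unfolded add_pow_def]\<close>)

lemma (in abelian_group) frag_eval_hom:
  assumes c: "\<And>a b. (a, b) \<in> S \<Longrightarrow> \<phi> a b \<in> carrier G"
  shows "frag_eval G \<phi> \<in> hom (free_Abelian_group S) (add_monoid G)"
proof (rule homI)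
  fix t assume t: "t \<in> carrier (free_Abelian_group S)"
  then show "frag_eval G \<phi> t \<in> carrier (add_monoid G)"
    unfolding frag_eval_def using c by (auto intro!: finsum_closed simp: subset_iff)
next
  fix s t assume s: "s \<in> carrier (free_Abelian_group S)" and t: "t \<in> carrier (free_Abelian_group S)"
  let ?W = "Poly_Mapping.keys s \<union> Poly_Mapping.keys t"
  have W: "finite ?W" "?W \<subseteq> S" using s t by auto
  have 1: "\<phi> (fst p) (snd p) \<in> carrier G" if "p \<in> ?W" for p
    using c W(2) that by (metis prod.collapse subsetD)
  have "frag_eval G \<phi> (s + t) = (\<Oplus>p\<in>?W. add_pow G (Poly_Mapping.lookup (s + t) p) (\<phi> (fst p) (snd p)))"
    by (rule frag_eval_superset[OF c W]) (use keys_add[of s t] in auto)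
  also have "\<dots> = (\<Oplus>p\<in>?W. add_pow G (Poly_Mapping.lookup s p) (\<phi> (fst p) (snd p)) \<oplus> add_pow G (Poly_Mapping.lookup t p) (\<phi> (fst p) (snd p)))"
    by (rule finsum_cong') (use 1 in \<open>auto simp: lookup_add add.int_pow_mult\<close>)
  also have "\<dots> = (\<Oplus>p\<in>?W. add_pow G (Poly_Mapping.lookup s p) (\<phi> (fst p) (snd p))) \<oplus> (\<Oplus>p\<in>?W. add_pow G (Poly_Mapping.lookup t p) (\<phi> (fst p) (snd p)))"
    by (rule finsum_addf) (use 1 in auto)
  also have "\<dots> = frag_eval G \<phi> s \<oplus> frag_eval G \<phi> t"
    using frag_eval_superset[OF c W, where t=s] frag_eval_superset[OF c W, where t=t] by simp
  finally show "frag_eval G \<phi> (s \<otimes>\<^bsub>free_Abelian_group S\<^esub> t) = frag_eval G \<phi> s \<otimes>\<^bsub>add_monoid G\<^esub> frag_eval G \<phi> t"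
    by simp
qed

lemma (in abelian_group) frag_eval_frag_of:
  "\<phi> a b \<in> carrier G \<Longrightarrow> frag_eval G \<phi> (frag_of (a, b)) = \<phi> a b"
  by (simp add: frag_eval_def finsum_insert[of "{}", simplified])

locale balanced_map = A: right_module K A + B: right_module K B + G: abelian_group G
  for K :: "('k, 'x) ring_scheme" and A :: "('k, 'a) rmodule" and B :: "('k, 'b) rmodule"
    and G :: "('g, 'y) ring_scheme" and \<phi> :: "'a \<Rightarrow> 'b \<Rightarrow> 'g" +
  assumes closed: "\<lbrakk>a \<in> carrier A; b \<in> carrier B\<rbrakk> \<Longrightarrow> \<phi> a b \<in> carrier G"
    and add_left: "\<lbrakk>a \<in> carrier A; a' \<in> carrier A; b \<in> carrier B\<rbrakk> \<Longrightarrow> \<phi> (a \<oplus>\<^bsub>A\<^esub> a') b = \<phi> a b \<oplus>\<^bsub>G\<^esub> \<phi> a' b"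
    and add_right: "\<lbrakk>a \<in> carrier A; b \<in> carrier B; b' \<in> carrier B\<rbrakk> \<Longrightarrow> \<phi> a (b \<oplus>\<^bsub>B\<^esub> b') = \<phi> a b \<oplus>\<^bsub>G\<^esub> \<phi> a b'"
    and bal: "\<lbrakk>a \<in> carrier A; b \<in> carrier B; c \<in> carrier K\<rbrakk> \<Longrightarrow> \<phi> (a \<bullet>\<^bsub>A\<^esub> c) b = \<phi> a (b \<bullet>\<^bsub>B\<^esub> c)"
begin

abbreviation "F \<equiv> free_Abelian_group (carrier A \<times> carrier B)"
abbreviation "N \<equiv> tensor_kernel K A B"

lemma rel: "tensor_relations K A B \<subseteq> carrier F"
proof -
  have *: "frag_of p - frag_of q - frag_of r \<in> carrier F" if "{p,q,r} \<subseteq> carrier A \<times> carrier B" for p q r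
    using that keys_diff[of "frag_of p - frag_of q" "frag_of r"] keys_diff[of "frag_of p" "frag_of q"] by auto
  have **: "frag_of p - frag_of q \<in> carrier F" if "{p,q} \<subseteq> carrier A \<times> carrier B" for p q
    using that keys_diff[of "frag_of p" "frag_of q"] by auto
  show ?thesis unfolding tensor_relations_def
    by (intro Un_least subsetI; elim CollectE exE conjE; hypsubst; intro * **)
       (auto simp: A.ract_closed B.ract_closed)
qed

lemma N_normal: "N \<lhd> F"
  unfolding tensor_kernel_def
  by (simp add: abelian_free_Abelian_group comm_group.normal_iff_subgroup group.generate_is_subgroup rel)

lemma eval_hom: "frag_eval G \<phi> \<in> hom F (add_monoid G)"
  by (rule G.frag_eval_hom) (auto simp: closed)

lemma eval_diff:
  assumes "x \<in> carrier F" "y \<in> carrier F"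
  shows "frag_eval G \<phi> (x - y) = frag_eval G \<phi> x \<ominus>\<^bsub>G\<^esub> frag_eval G \<phi> y"
proof -
  interpret h: group_hom F "add_monoid G" "frag_eval G \<phi>"
    by (simp add: group_hom_def group_hom_axioms_def eval_hom G.a_group)
  have "frag_eval G \<phi> (x \<otimes>\<^bsub>F\<^esub> inv\<^bsub>F\<^esub> y) = frag_eval G \<phi> x \<otimes>\<^bsub>add_monoid G\<^esub> inv\<^bsub>add_monoid G\<^esub> frag_eval G \<phi> y"
    using assms h.hom_mult h.hom_inv by (metis h.G.inv_closed)
  then show ?thesis using assms by (simp add: a_minus_def a_inv_def)
qed

lemma eval_rel: "r \<in> tensor_relations K A B \<Longrightarrow> frag_eval G \<phi> r = \<zero>\<^bsub>G\<^esub>"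
proof -
  have d: "frag_of p - frag_of q \<in> carrier F" if "p \<in> carrier A \<times> carrier B" "q \<in> carrier A \<times> carrier B" for p q
    using that keys_diff[of "frag_of p" "frag_of q"] by auto
  have e: "frag_eval G \<phi> (frag_of (a,b)) = \<phi> a b" if "a \<in> carrier A" "b \<in> carrier B" for a b
    by (rule G.frag_eval_frag_of) (rule closed[OF that])
  have f: "frag_of (a,b) \<in> carrier F"  if "a \<in> carrier A" "b \<in> carrier B" for a b using that by simp
  have g: "x \<oplus>\<^bsub>G\<^esub> y \<ominus>\<^bsub>G\<^esub> x \<ominus>\<^bsub>G\<^esub> y = \<zero>\<^bsub>G\<^esub>" if "x \<in> carrier G" "y \<in> carrier G" for x y
  proof -
    have "x \<oplus>\<^bsub>G\<^esub> y \<ominus>\<^bsub>G\<^esub> x = y \<oplus>\<^bsub>G\<^esub> (x \<oplus>\<^bsub>G\<^esub> \<ominus>\<^bsub>G\<^esub> x)"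
      using that by (simp only: a_minus_def G.a_comm[of x y] G.a_assoc G.a_inv_closed)
    then show "x \<oplus>\<^bsub>G\<^esub> y \<ominus>\<^bsub>G\<^esub> x \<ominus>\<^bsub>G\<^esub> y = \<zero>\<^bsub>G\<^esub>" using that by (simp_all add: G.r_neg a_minus_def)
  qed
  have g': "x \<ominus>\<^bsub>G\<^esub> x = \<zero>\<^bsub>G\<^esub>" if "x \<in> carrier G" for x using that by (simp add: G.r_neg a_minus_def)
  assume "r \<in> tensor_relations K A B"
  then show ?thesis unfolding tensor_relations_def
    by (elim UnE CollectE exE conjE)
       (simp_all only: eval_diff d f e A.ract_closed B.ract_closed A.M.a_closed B.M.a_closed closed add_left add_right bal g g' mem_Sigma_iff simp_thms)
qed

lemma N_ker: "x \<in> N \<Longrightarrow> frag_eval G \<phi> x = \<zero>\<^bsub>G\<^esub>"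
proof -
  interpret h: group_hom F "add_monoid G" "frag_eval G \<phi>"
    by (simp add: group_hom_def group_hom_axioms_def eval_hom G.a_group)
  have "tensor_relations K A B \<subseteq> kernel F (add_monoid G) (frag_eval G \<phi>)"
    using rel eval_rel unfolding kernel_def by (auto simp del: carrier_free_Abelian_group_iff)
  then have "N \<subseteq> kernel F (add_monoid G) (frag_eval G \<phi>)"
    unfolding tensor_kernel_def by (intro h.G.generate_subgroup_incl) (auto simp: h.subgroup_kernel)
  then show "x \<in> N \<Longrightarrow> ?thesis" by (auto simp: kernel_def)
qed

lemma lift_eq: "t \<in> carrier F \<Longrightarrow> tensor_lift G \<phi> (N #>\<^bsub>F\<^esub> t) = frag_eval G \<phi> t"
proof -
  interpret h: group_hom F "add_monoid G" "frag_eval G \<phi>"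
    by (simp add: group_hom_def group_hom_axioms_def eval_hom G.a_group)
  interpret N: normal N F by (rule N_normal)
  assume t: "t \<in> carrier F"
  have *: "frag_eval G \<phi> s = frag_eval G \<phi> t" if s: "s \<in> N #>\<^bsub>F\<^esub> t" for s
  proof -
    obtain n where n: "n \<in> N" "s = n \<otimes>\<^bsub>F\<^esub> t" using s unfolding r_coset_def by (elim UN_E singletonE)
    have "n \<in> carrier F" using n N.subset by blast
    then show ?thesis using n(2) h.hom_mult[of n t] t N_ker[OF n(1)] h.hom_closed[OF t] by simp
  qed
  have "t \<in> N #>\<^bsub>F\<^esub> t" by (rule h.G.rcos_self[OF t N.subgroup_axioms])
  then have "(SOME s. s \<in> N #>\<^bsub>F\<^esub> t) \<in> N #>\<^bsub>F\<^esub> t" by (rule someI)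
  from *[OF this] show ?thesis by (simp add: tensor_lift_def)
qed

lemma lift_pure: "\<lbrakk>a \<in> carrier A; b \<in> carrier B\<rbrakk> \<Longrightarrow> tensor_lift G \<phi> (pure K A B a b) = \<phi> a b"
  unfolding pure_def by (subst lift_eq) (auto simp: closed G.frag_eval_frag_of)

lemma lift_hom: "tensor_lift G \<phi> \<in> hom (add_monoid (tensor_group K A B)) (add_monoid G)"
proof -
  interpret h: group_hom F "add_monoid G" "frag_eval G \<phi>"
    by (simp add: group_hom_def group_hom_axioms_def eval_hom G.a_group)
  interpret N: normal N F by (rule N_normal)
  show ?thesis
  proof (rule homI; simp add: tensor_group_def Let_def FactGroup_def del: mult_free_Abelian_group)
    fix S assume "S \<in> rcosets\<^bsub>F\<^esub> N"
    then obtain s where s: "s \<in> carrier F" "S = N #>\<^bsub>F\<^esub> s" by (auto simp: RCOSETS_def)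
    show "tensor_lift G \<phi> S \<in> carrier G" using s lift_eq h.hom_closed by simp
    fix T assume "T \<in> rcosets\<^bsub>F\<^esub> N"
    then obtain t where t: "t \<in> carrier F" "T = N #>\<^bsub>F\<^esub> t" by (auto simp: RCOSETS_def)
    show "tensor_lift G \<phi> (S <#>\<^bsub>F\<^esub> T) = tensor_lift G \<phi> S \<oplus>\<^bsub>G\<^esub> tensor_lift G \<phi> T"
      using s t lift_eq h.hom_mult[of s t] h.G.m_closed[of s t] N.rcos_sum[of s t]
      by (metis monoid.simps(1))
  qed
qed

end


section \<open>Finitely generated modules have copies carried by \<open>'u\<close>\<close>

fun lincomb :: "('r, 'm) rmodule \<Rightarrow> 'm list \<Rightarrow> 'r list \<Rightarrow> 'm" where
  "lincomb M (a # as) (r # rs) = (a \<bullet>\<^bsub>M\<^esub> r) \<oplus>\<^bsub>M\<^esub> lincomb M as rs"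
| "lincomb M _ _ = \<zero>\<^bsub>M\<^esub>"

context right_module begin

lemma lincomb_closed: "set as \<subseteq> carrier M \<Longrightarrow> set rs \<subseteq> carrier R \<Longrightarrow> lincomb M as rs \<in> carrier M"
  by (induction as rs rule: list_induct2') (auto simp: ract_closed)

lemma zero_ract: "r \<in> carrier R \<Longrightarrow> \<zero>\<^bsub>M\<^esub> \<bullet>\<^bsub>M\<^esub> r = \<zero>\<^bsub>M\<^esub>"
  using ract_add_left[of "\<zero>\<^bsub>M\<^esub>" "\<zero>\<^bsub>M\<^esub>" r] ract_closed[of "\<zero>\<^bsub>M\<^esub>" r] by (simp add: M.add.l_cancel_one')

lemma ract_zero: "x \<in> carrier M \<Longrightarrow> x \<bullet>\<^bsub>M\<^esub> \<zero>\<^bsub>R\<^esub> = \<zero>\<^bsub>M\<^esub>"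
  using ract_add_right[of x "\<zero>\<^bsub>R\<^esub>" "\<zero>\<^bsub>R\<^esub>"] ract_closed[of x "\<zero>\<^bsub>R\<^esub>"] by (simp add: M.add.l_cancel_one')

lemma ract_minus_one: "x \<in> carrier M \<Longrightarrow> x \<bullet>\<^bsub>M\<^esub> (\<ominus>\<^bsub>R\<^esub> \<one>\<^bsub>R\<^esub>) = \<ominus>\<^bsub>M\<^esub> x"
  using ract_add_right[of x "\<ominus>\<^bsub>R\<^esub> \<one>\<^bsub>R\<^esub>" "\<one>\<^bsub>R\<^esub>"]
  by (metis M.minus_equality R.add.inv_closed R.l_neg R.one_closed ract_closed ract_one ract_zero)

lemma lincomb_ract: "set as \<subseteq> carrier M \<Longrightarrow> set rs \<subseteq> carrier R \<Longrightarrow> r \<in> carrier R \<Longrightarrow>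
  lincomb M as rs \<bullet>\<^bsub>M\<^esub> r = lincomb M as (map (\<lambda>s. s \<otimes>\<^bsub>R\<^esub> r) rs)"
  by (induction as rs rule: list_induct2')
     (auto simp: ract_closed lincomb_closed ract_add_left ract_assoc zero_ract)

lemma lincomb_add: "set as \<subseteq> carrier M \<Longrightarrow> length rs = length as \<Longrightarrow> length ss = length as \<Longrightarrow> set rs \<subseteq> carrier R \<Longrightarrow> set ss \<subseteq> carrier R \<Longrightarrow>
  lincomb M as rs \<oplus>\<^bsub>M\<^esub> lincomb M as ss = lincomb M as (map2 (\<oplus>\<^bsub>R\<^esub>) rs ss)"
proof (induction as arbitrary: rs ss)
  case (Cons a as)
  obtain r rs' s ss' where [simp]: "rs = r # rs'" "ss = s # ss'"
    using Cons.prems by (metis length_Suc_conv)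
  have "lincomb M as rs' \<oplus>\<^bsub>M\<^esub> lincomb M as ss' = lincomb M as (map2 (\<oplus>\<^bsub>R\<^esub>) rs' ss')"
    using Cons by auto
  then show ?case using Cons.prems
    by (simp add: ract_add_right ract_closed lincomb_closed flip: \<open>_ = lincomb M as (map2 _ rs' ss')\<close>) (simp add: M.a_ac ract_closed lincomb_closed)
qed simp

lemma lincomb_zero: "set as \<subseteq> carrier M \<Longrightarrow> lincomb M as (map (\<lambda>_. \<zero>\<^bsub>R\<^esub>) as) = \<zero>\<^bsub>M\<^esub>"
  by (induction as) (auto simp: ract_zero)

lemma lincomb_gen: "set as \<subseteq> carrier M \<Longrightarrow> a \<in> set as \<Longrightarrow> \<exists>rs. set rs \<subseteq> carrier R \<and> length rs = length as \<and> lincomb M as rs = a"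
proof (induction as)
  case (Cons b as)
  show ?case
  proof (cases "a = b")
    case True
    show ?thesis using Cons.prems
      by (intro exI[of _ "\<one>\<^bsub>R\<^esub> # map (\<lambda>_. \<zero>\<^bsub>R\<^esub>) as"]) (auto simp: True lincomb_zero ract_one)
  next
    case False
    then obtain rs where "set rs \<subseteq> carrier R \<and> length rs = length as \<and> lincomb M as rs = a" using Cons by auto
    then show ?thesis using Cons.prems by (intro exI[of _ "\<zero>\<^bsub>R\<^esub> # rs"]) (auto simp: ract_zero)
  qed
qed simp

lemma lincomb_submodule:
  assumes "set as \<subseteq> carrier M"
  shows "rsubmodule R M (lincomb M as ` {rs. set rs \<subseteq> carrier R \<and> length rs = length as})" (is "rsubmodule R M ?N")
proof -
  have act: "x \<bullet>\<^bsub>M\<^esub> r \<in> ?N" if x: "x \<in> ?N" and r: "r \<in> carrier R" for x r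
  proof -
    obtain rs where rs: "x = lincomb M as rs" "set rs \<subseteq> carrier R" "length rs = length as" using x by blast
    then have "x \<bullet>\<^bsub>M\<^esub> r = lincomb M as (map (\<lambda>s. s \<otimes>\<^bsub>R\<^esub> r) rs)" using lincomb_ract assms r by blast
    then show ?thesis using rs r by (auto intro!: imageI simp: subset_iff)
  qed
  have sub: "?N \<subseteq> carrier M" using assms lincomb_closed by blast
  have "subgroup ?N (add_monoid M)"
  proof (rule M.add.subgroupI)
    show "?N \<subseteq> carrier M" by (rule sub)
    have "\<exists>rs. set rs \<subseteq> carrier R \<and> length rs = length as"
      by (rule exI[of _ "map (\<lambda>_. \<zero>\<^bsub>R\<^esub>) as"]) auto
    then show "?N \<noteq> {}" by auto
  next
    fix x assume x: "x \<in> ?N"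
    then have "x \<in> carrier M" using sub by blast
    from ract_minus_one[OF this] act[OF x, of "\<ominus>\<^bsub>R\<^esub> \<one>\<^bsub>R\<^esub>"] show "\<ominus>\<^bsub>M\<^esub> x \<in> ?N" by simp
  next
    fix x y assume x: "x \<in> ?N" and y: "y \<in> ?N"
    obtain rs where rs: "x = lincomb M as rs" "set rs \<subseteq> carrier R" "length rs = length as" using x by auto
    obtain ss where ss: "y = lincomb M as ss" "set ss \<subseteq> carrier R" "length ss = length as" using y by auto
    note * = rs(1) ss(1) rs(2,3) ss(2,3)
    let ?qs = "map2 (\<oplus>\<^bsub>R\<^esub>) rs ss"
    have "x \<oplus>\<^bsub>M\<^esub> y = lincomb M as ?qs" unfolding *(1,2) by (rule lincomb_add) (use * assms in auto)
    moreover have "set ?qs \<subseteq> carrier R"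
    proof
      fix q assume "q \<in> set ?qs"
      then obtain r s where "(r, s) \<in> set (zip rs ss)" "q = r \<oplus>\<^bsub>R\<^esub> s" by auto
      then show "q \<in> carrier R" using *(3,5) set_zip_leftD[of r s rs ss] set_zip_rightD[of r s rs ss] by auto
    qed
    moreover have "length ?qs = length as" using * by simp
    ultimately show "x \<oplus>\<^bsub>M\<^esub> y \<in> ?N" by blast
  qed
  then show ?thesis unfolding rsubmodule_def using act by (auto intro: additive_subgroup.intro)
qed

lemma fin_gen_lepoll:
  assumes "fin_gen R M" shows "carrier M \<lesssim> lists (carrier R)"
proof -
  obtain A where A: "finite A" "A \<subseteq> carrier M" "rspan R M A = carrier M" using assms by (auto simp: fin_gen_def)
  obtain as where as: "set as = A" using A(1) finite_list by blast
  let ?N = "lincomb M as ` {rs. set rs \<subseteq> carrier R \<and> length rs = length as}"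
  have "A \<subseteq> ?N"
  proof
    fix a assume "a \<in> A"
    then obtain rs where "set rs \<subseteq> carrier R" "length rs = length as" "lincomb M as rs = a"
      using lincomb_gen[of as a] A(2) as by auto
    then show "a \<in> ?N" by blast
  qed
  then have "carrier M \<subseteq> ?N"
    using lincomb_submodule[of as] A as unfolding rspan_def by blast
  then have "carrier M \<subseteq> lincomb M as ` lists (carrier R)" by (auto simp: lists_eq_set)
  then show ?thesis using subset_image_lepoll by blast
qed
end

lemma fin_gen_copy:
  fixes R :: "('r, 'x) ring_scheme" and M :: "('r, 'm) rmodule"
  assumes "right_module R M" "fin_gen R M" and "lists (carrier R) \<lesssim> (UNIV :: 'u set)"
  shows "\<exists>M'\<in>(fmod R :: ('r, 'u) rmodule set). rmod_isomorphic R M' M"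
proof -
  interpret right_module R M by fact
  obtain j :: "'m \<Rightarrow> 'u" where j: "inj_on j (carrier M)"
    using lepoll_trans[OF fin_gen_lepoll[OF assms(2)] assms(3)] by (auto simp: lepoll_def)
  define i where "i = inv_into (carrier M) j"
  have ij[simp]: "x \<in> carrier M \<Longrightarrow> i (j x) = x" for x using j by (simp add: i_def)
  define M' :: "('r, 'u) rmodule" where "M' = \<lparr>carrier = j ` carrier M, monoid.mult = undefined, one = undefined,
    ring.zero = j \<zero>\<^bsub>M\<^esub>, ring.add = (\<lambda>x y. j (i x \<oplus>\<^bsub>M\<^esub> i y)), ract = (\<lambda>x r. j (i x \<bullet>\<^bsub>M\<^esub> r))\<rparr>"
  have M': "carrier M' = j ` carrier M" "\<zero>\<^bsub>M'\<^esub> = j \<zero>\<^bsub>M\<^esub>" "x \<oplus>\<^bsub>M'\<^esub> y = j (i x \<oplus>\<^bsub>M\<^esub> i y)"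
    "x \<bullet>\<^bsub>M'\<^esub> r = j (i x \<bullet>\<^bsub>M\<^esub> r)" for x y r by (simp_all add: M'_def)
  have ag: "abelian_group M'"
  proof (rule abelian_groupI)
    fix x assume "x \<in> carrier M'"
    then obtain a where a: "a \<in> carrier M" "x = j a" by (auto simp: M')
    then show "\<exists>y\<in>carrier M'. y \<oplus>\<^bsub>M'\<^esub> x = \<zero>\<^bsub>M'\<^esub>"
      by (intro bexI[of _ "j (\<ominus>\<^bsub>M\<^esub> a)"]) (auto simp: M' M.l_neg)
  qed (auto simp: M' M.a_ac)
  have rm: "right_module R M'"
    using ag R.ring_axioms
    by (intro right_module.intro right_module_axioms.intro)
       (auto simp: M' ract_closed ract_add_left ract_add_right ract_assoc ract_one)
  have hom: "i \<in> rmod_hom R M' M"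
    by (auto simp: rmod_hom_def hom_def M' ract_closed)
  have bij: "bij_betw i (carrier M') (carrier M)"
    unfolding i_def M' using j by (simp add: bij_betw_inv_into inj_on_imp_bij_betw)
  have "fin_gen R M'"
  proof -
    obtain A where A: "finite A" "A \<subseteq> carrier M" "rspan R M A = carrier M" using assms by (auto simp: fin_gen_def)
    have "rspan R M' (j ` A) = carrier M'"
    proof
      have "rsubmodule R M' (carrier M')"
        using rm abelian_group.a_group[OF ag] by (auto simp: rsubmodule_def right_module.ract_closed intro!: additive_subgroup.intro group.subgroup_self[of "add_monoid M'", simplified])
      then show "rspan R M' (j ` A) \<subseteq> carrier M'" using A(2) unfolding rspan_def M' by blast
      show "carrier M' \<subseteq> rspan R M' (j ` A)"
        unfolding rspan_def
      proof (rule Inter_greatest, clarify)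
        fix N x assume N: "rsubmodule R M' N" "j ` A \<subseteq> N" and x: "x \<in> carrier M'"
        interpret N: additive_subgroup N M' using N by (simp add: rsubmodule_def)
        interpret M': abelian_group M' by (rule ag)
        let ?N = "{y \<in> carrier M. j y \<in> N}"
        have ra: "j (y \<bullet>\<^bsub>M\<^esub> r) \<in> N" if "y \<in> carrier M" "j y \<in> N" "r \<in> carrier R" for y r
          using N(1) that by (auto simp: rsubmodule_def M')
        have "rsubmodule R M ?N" unfolding rsubmodule_def
        proof (intro conjI additive_subgroup.intro M.add.subgroupI)
          show "?N \<noteq> {}" using N.zero_closed by (auto simp: M')
          show "\<ominus>\<^bsub>M\<^esub> a \<in> ?N" if "a \<in> ?N" for a using ra[of a "\<ominus>\<^bsub>R\<^esub> \<one>\<^bsub>R\<^esub>"] that by (simp add: ract_minus_one)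
          show "a \<oplus>\<^bsub>M\<^esub> b \<in> ?N" if "a \<in> ?N" "b \<in> ?N" for a b
            using that N.a_closed[of "j a" "j b"] by (auto simp: M')
        qed (use ra ract_closed in auto)
        moreover have "A \<subseteq> ?N" using A N by auto
        ultimately have "carrier M \<subseteq> ?N" using A(3) unfolding rspan_def by blast
        then show "x \<in> N" using x by (auto simp: M')
      qed
    qed
    then show ?thesis unfolding fin_gen_def using A by (intro exI[of _ "j ` A"]) (auto simp: M')
  qed
  then show ?thesis using rm hom bij unfolding fmod_def rmod_isomorphic_def by blast
qed

end

theory Submission
  imports Defs
begin

text \<open>Let \<open>X\<close> be a nonzero object of a tensor torsion class. The \<open>H\<close>-module \<open>X \<otimes> H\<close> lies in the
  class. As for the untwisting of \<open>X \<otimes> H\<close> into a free module, every \<open>K\<close>-linear form \<open>\<lambda>\<close> on \<open>X\<close>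
  gives an \<open>H\<close>-linear map \<open>X \<otimes> H \<rightarrow> H\<close>, \<open>x \<otimes> h \<mapsto> \<Sum> \<lambda>(x S(h\<^sub>1)) h\<^sub>2\<close>, which sends \<open>(x \<otimes> 1) h\<close> to \<open>\<lambda>(x) h\<close>.
  It is surjective as soon as \<open>\<lambda>\<close> takes the value 1, so \<open>H\<close> is a quotient of an object of the
  class. Every finitely generated module is a quotient of a finite power of \<open>H\<close>, hence lies in the class.
  Finite generation of \<open>X \<otimes> H\<close> is part of the ideal property.\<close>

section \<open>Tensor products\<close>

text \<open>The form \<open>\<lambda>\<close> is the last factor of the untwisting. The map x (x) h
  |-> sum of x S(h1) (x) h2 carries the diagonal action on X (x) H to the action on the right factor
  alone, and applying \<open>\<lambda>\<close> to the left factor leaves an H-linear map to H.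
  Linearity is the delicate point. Computed directly on x (x) h it calls for S(hk) = S(k) S(h),
  which the axioms do not state. It is therefore checked on the elements (x (x) 1) h, which generate
  X (x) H as a group; there it reduces to associativity of the action on X (x) H. The module axioms
  for X (x) H in turn come from the class: the ideal property makes X (x) H isomorphic to an object
  of the class, and the axioms are transported along the isomorphism. A Sweedler sum is a
  \<open>tensor_lift\<close>, evaluated at a chosen representative of a coset. Such sums can be
  compared only once their integrands are known to be balanced, and a triple sum can change its
  bracketing only once its integrand is known to be trilinear. Most of the auxiliary statements
  serve this purpose.\<close>

lemma add_hom_zero:
  assumes "abelian_group P" "abelian_group G" "f \<in> hom (add_monoid P) (add_monoid G)"
  shows "f \<zero>\<^bsub>P\<^esub> = \<zero>\<^bsub>G\<^esub>"
  using group_hom.hom_one[of "add_monoid P" "add_monoid G" f] assms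
  by (simp add: group_hom_def group_hom_axioms_def abelian_group.a_group)

lemma add_hom_minus:
  assumes "abelian_group P" "abelian_group G" "f \<in> hom (add_monoid P) (add_monoid G)" "x \<in> carrier P"
  shows "f (\<ominus>\<^bsub>P\<^esub> x) = \<ominus>\<^bsub>G\<^esub> f x"
  using group_hom.hom_inv[of "add_monoid P" "add_monoid G" f x] assms
  by (simp add: group_hom_def group_hom_axioms_def abelian_group.a_group a_inv_def)

lemma (in abelian_group) eq_if_diff_zero:
  "\<lbrakk>x \<ominus> y = \<zero>; x \<in> carrier G; y \<in> carrier G\<rbrakk> \<Longrightarrow> x = y"
  using minus_equality[of x "\<ominus> y"] by (simp add: a_minus_def)

section \<open>The tensor group of two modules and its universal property\<close>

locale tensor_pair = A: right_module K A + B: right_module K B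
  for K :: "('k, 'x) ring_scheme" and A :: "('k, 'a) rmodule" and B :: "('k, 'b) rmodule"
begin

abbreviation "Fr \<equiv> free_Abelian_group (carrier A \<times> carrier B)"
abbreviation "Nt \<equiv> tensor_kernel K A B"
abbreviation "T \<equiv> tensor_group K A B"

text \<open>The facts about the subgroup of relations are proved in \<open>balanced_map\<close>,
  which asks for some map. The zero map gives access to them for any pair of modules.\<close>

lemma zero_balanced: "balanced_map K A B A (\<lambda>_ _. \<zero>\<^bsub>A\<^esub>)"
  by unfold_locales auto

lemmas N_normal = balanced_map.N_normal[OF zero_balanced]

lemma tensor_group_simps:
  "carrier T = carrier (Fr Mod Nt)" "\<zero>\<^bsub>T\<^esub> = \<one>\<^bsub>Fr Mod Nt\<^esub>" "x \<oplus>\<^bsub>T\<^esub> y = x \<otimes>\<^bsub>Fr Mod Nt\<^esub> y"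
  by (simp_all add: tensor_group_def Let_def)

lemma add_monoid_tensor_group: "comm_group (add_monoid T)"
proof -
  interpret Fr: comm_group Fr by (rule abelian_free_Abelian_group)
  interpret Nt: normal Nt Fr by (rule N_normal)
  have "comm_group (Fr Mod Nt)" by (rule Fr.abelian_FactGroup[OF Nt.subgroup_axioms])
  moreover have "add_monoid T = Fr Mod Nt"
    by (simp add: tensor_group_def Let_def FactGroup_def)
  ultimately show ?thesis by simp
qed

lemma tensor_abelian_group: "abelian_group T"
  using add_monoid_tensor_group
  by (simp add: abelian_group_def abelian_group_axioms_def abelian_monoid_def comm_group_def)

sublocale T: abelian_group T by (rule tensor_abelian_group)

lemma coset_hom: "(\<lambda>t. Nt #>\<^bsub>Fr\<^esub> t) \<in> hom Fr (add_monoid T)"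
proof -
  interpret Nt: normal Nt Fr by (rule N_normal)
  have "(\<lambda>t. Nt #>\<^bsub>Fr\<^esub> t) \<in> hom Fr (Fr Mod Nt)" by (rule Nt.r_coset_hom_Mod)
  then show ?thesis by (simp add: hom_def tensor_group_simps)
qed

lemma coset_group_hom: "group_hom Fr (add_monoid T) (\<lambda>t. Nt #>\<^bsub>Fr\<^esub> t)"
  using coset_hom T.a_group by (simp only: group_hom_def group_hom_axioms_def group_free_Abelian_group simp_thms)

lemma coset_closed: "t \<in> carrier Fr \<Longrightarrow> Nt #>\<^bsub>Fr\<^esub> t \<in> carrier T"
  using coset_hom by (auto simp: hom_def)

lemma coset_diff:
  assumes "s \<in> carrier Fr" "t \<in> carrier Fr"
  shows "Nt #>\<^bsub>Fr\<^esub> (s - t) = (Nt #>\<^bsub>Fr\<^esub> s) \<ominus>\<^bsub>T\<^esub> (Nt #>\<^bsub>Fr\<^esub> t)"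
proof -
  interpret h: group_hom Fr "add_monoid T" "\<lambda>t. Nt #>\<^bsub>Fr\<^esub> t" by (rule coset_group_hom)
  have "Nt #>\<^bsub>Fr\<^esub> (s \<otimes>\<^bsub>Fr\<^esub> inv\<^bsub>Fr\<^esub> t) = (Nt #>\<^bsub>Fr\<^esub> s) \<otimes>\<^bsub>add_monoid T\<^esub> inv\<^bsub>add_monoid T\<^esub> (Nt #>\<^bsub>Fr\<^esub> t)"
    using assms h.hom_mult h.hom_inv by (metis h.G.inv_closed)
  then show ?thesis using assms by (simp add: a_minus_def a_inv_def)
qed

lemma coset_rel: "r \<in> tensor_relations K A B \<Longrightarrow> Nt #>\<^bsub>Fr\<^esub> r = \<zero>\<^bsub>T\<^esub>"
proof -
  assume r: "r \<in> tensor_relations K A B"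
  interpret Nt: normal Nt Fr by (rule N_normal)
  have "r \<in> Nt" unfolding tensor_kernel_def using r by (rule generate.incl)
  then show ?thesis by (simp add: tensor_group_simps Nt.rcos_const)
qed

lemma pure_closed: "\<lbrakk>a \<in> carrier A; b \<in> carrier B\<rbrakk> \<Longrightarrow> pure K A B a b \<in> carrier T"
  unfolding pure_def by (rule coset_closed) simp

lemma frag_carrier: "\<lbrakk>a \<in> carrier A; b \<in> carrier B\<rbrakk> \<Longrightarrow> frag_of (a, b) \<in> carrier Fr"
  by simp

lemma diff_carrier: "\<lbrakk>s \<in> carrier Fr; t \<in> carrier Fr\<rbrakk> \<Longrightarrow> s - t \<in> carrier Fr"
  using keys_diff[of s t] by auto

text \<open>Each of the three laws is one family of \<open>tensor_relations\<close>, whose cosets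
  vanish by \<open>coset_rel\<close>.\<close>

lemma pure_balanced: "balanced_map K A B T (pure K A B)"
proof -
  have *: "x = y \<oplus>\<^bsub>T\<^esub> z" if "x \<ominus>\<^bsub>T\<^esub> y \<ominus>\<^bsub>T\<^esub> z = \<zero>\<^bsub>T\<^esub>" "x \<in> carrier T" "y \<in> carrier T" "z \<in> carrier T" for x y z
    by (rule T.eq_if_diff_zero) (use that in \<open>simp_all add: a_minus_def T.minus_add T.a_assoc\<close>)
  show ?thesis
  proof unfold_locales
    fix a a' b assume h: "a \<in> carrier A" "a' \<in> carrier A" "b \<in> carrier B"
    have "frag_of (a \<oplus>\<^bsub>A\<^esub> a', b) - frag_of (a, b) - frag_of (a', b) \<in> tensor_relations K A B"
      unfolding tensor_relations_def using h by blast
    from coset_rel[OF this] show "pure K A B (a \<oplus>\<^bsub>A\<^esub> a') b = pure K A B a b \<oplus>\<^bsub>T\<^esub> pure K A B a' b"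
      using h by - (rule *, auto simp only: coset_diff diff_carrier frag_carrier pure_def coset_closed A.M.a_closed)
  next
    fix a b b' assume h: "a \<in> carrier A" "b \<in> carrier B" "b' \<in> carrier B"
    have "frag_of (a, b \<oplus>\<^bsub>B\<^esub> b') - frag_of (a, b) - frag_of (a, b') \<in> tensor_relations K A B"
      unfolding tensor_relations_def using h by blast
    from coset_rel[OF this] show "pure K A B a (b \<oplus>\<^bsub>B\<^esub> b') = pure K A B a b \<oplus>\<^bsub>T\<^esub> pure K A B a b'"
      using h by - (rule *, auto simp only: coset_diff diff_carrier frag_carrier pure_def coset_closed B.M.a_closed)
  next
    fix a b c assume h: "a \<in> carrier A" "b \<in> carrier B" "c \<in> carrier K"
    have "frag_of (a \<bullet>\<^bsub>A\<^esub> c, b) - frag_of (a, b \<bullet>\<^bsub>B\<^esub> c) \<in> tensor_relations K A B"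
      unfolding tensor_relations_def using h by blast
    from coset_rel[OF this] show "pure K A B (a \<bullet>\<^bsub>A\<^esub> c) b = pure K A B a (b \<bullet>\<^bsub>B\<^esub> c)"
      using h by - (rule T.eq_if_diff_zero, auto simp only: coset_diff diff_carrier frag_carrier pure_def coset_closed A.ract_closed B.ract_closed)
  qed (rule pure_closed)
qed

text \<open>Representatives are integer combinations of pairs. Closing under differences rather than
  sums also reaches the negative coefficients.\<close>

lemma tensor_induct [consumes 1, case_names zero pure diff]:
  assumes t: "t \<in> carrier T"
    and zero: "P \<zero>\<^bsub>T\<^esub>"
    and pure: "\<And>a b. \<lbrakk>a \<in> carrier A; b \<in> carrier B\<rbrakk> \<Longrightarrow> P (pure K A B a b)"
    and diff: "\<And>s t. \<lbrakk>s \<in> carrier T; t \<in> carrier T; P s; P t\<rbrakk> \<Longrightarrow> P (s \<ominus>\<^bsub>T\<^esub> t)"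
  shows "P t"
proof -
  obtain x where x: "x \<in> carrier Fr" "t = Nt #>\<^bsub>Fr\<^esub> x"
    using t by (auto simp: tensor_group_simps FactGroup_def RCOSETS_def)
  have "x \<in> carrier Fr \<and> P (Nt #>\<^bsub>Fr\<^esub> x)" using x(1)[simplified]
  proof (induction x rule: frag_induction)
    case zero
    then show ?case using assms(2) group_hom.hom_one[OF coset_group_hom] by simp
  next
    case (one p)
    then show ?case using pure[of "fst p" "snd p"] by (auto simp: pure_def)
  next
    case (diff a b)
    then show ?case using diff_carrier[of a b] coset_diff[of a b] assms(4) coset_closed by metis
  qed
  then show ?thesis using x by simp
qed

text \<open>The uniqueness half of the universal property. Identities between additive maps on
  tensors are reduced to pure tensors through it.\<close>

lemma tensor_ext:
  assumes "abelian_group G" "f \<in> hom (add_monoid T) (add_monoid G)" "g \<in> hom (add_monoid T) (add_monoid G)"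
    and eq: "\<And>a b. \<lbrakk>a \<in> carrier A; b \<in> carrier B\<rbrakk> \<Longrightarrow> f (pure K A B a b) = g (pure K A B a b)"
    and "t \<in> carrier T"
  shows "f t = g t"
  using \<open>t \<in> carrier T\<close>
proof (induction rule: tensor_induct)
  case zero
  show ?case using assms(1-3) add_hom_zero[OF tensor_abelian_group] by metis
next
  case (diff s t)
  have "f (s \<oplus>\<^bsub>T\<^esub> \<ominus>\<^bsub>T\<^esub> t) = g (s \<oplus>\<^bsub>T\<^esub> \<ominus>\<^bsub>T\<^esub> t)"
    using diff assms(2,3) add_hom_minus[OF tensor_abelian_group assms(1,2)]
      add_hom_minus[OF tensor_abelian_group assms(1,3)] by (simp add: hom_def)
  then show ?case by (simp add: a_minus_def)
qed (rule eq)

end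

lemma balanced_tensor_pair: "balanced_map K A B G \<phi> \<Longrightarrow> tensor_pair K A B"
  by (simp add: balanced_map_def tensor_pair_def)

lemma balanced_abelian_group: "balanced_map K A B G \<phi> \<Longrightarrow> abelian_group G"
  by (simp add: balanced_map_def)

lemma balanced_cong:
  assumes "balanced_map K A B G \<phi>"
    and "\<And>a b. \<lbrakk>a \<in> carrier A; b \<in> carrier B\<rbrakk> \<Longrightarrow> \<phi> a b = \<psi> a b"
  shows "balanced_map K A B G \<psi>"
proof -
  interpret balanced_map K A B G \<phi> by fact
  show ?thesis
    by unfold_locales (simp_all add: closed add_left add_right bal A.ract_closed B.ract_closed flip: assms(2))
qed

lemma lift_unique:
  assumes "balanced_map K A B G \<phi>" and "f \<in> hom (add_monoid (tensor_group K A B)) (add_monoid G)"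
    and "\<And>a b. \<lbrakk>a \<in> carrier A; b \<in> carrier B\<rbrakk> \<Longrightarrow> f (pure K A B a b) = \<phi> a b"
    and "t \<in> carrier (tensor_group K A B)"
  shows "f t = tensor_lift G \<phi> t"
proof (rule tensor_pair.tensor_ext[OF balanced_tensor_pair[OF assms(1)] balanced_abelian_group[OF assms(1)]
      assms(2) balanced_map.lift_hom[OF assms(1)] _ assms(4)])
  fix a b assume "a \<in> carrier A" "b \<in> carrier B"
  then show "f (pure K A B a b) = tensor_lift G \<phi> (pure K A B a b)"
    by (simp only: assms(3) balanced_map.lift_pure[OF assms(1)])
qed

text \<open>The two integrands agree only on the carriers, so plain rewriting does not apply;
  uniqueness of the lift does.\<close>

lemma lift_cong:
  assumes "balanced_map K A B G \<phi>"
    and "\<And>a b. \<lbrakk>a \<in> carrier A; b \<in> carrier B\<rbrakk> \<Longrightarrow> \<phi> a b = \<psi> a b"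
    and "t \<in> carrier (tensor_group K A B)"
  shows "tensor_lift G \<phi> t = tensor_lift G \<psi> t"
  by (rule lift_unique[OF balanced_cong[OF assms(1,2)] balanced_map.lift_hom[OF assms(1)] _ assms(3)])
    (simp_all only: balanced_map.lift_pure[OF assms(1)] assms(2))

lemma lift_closed:
  assumes "balanced_map K A B G \<phi>" and "t \<in> carrier (tensor_group K A B)"
  shows "tensor_lift G \<phi> t \<in> carrier G"
  using balanced_map.lift_hom[OF assms(1)] assms(2) by (auto simp: hom_def)

lemma lift_plus:
  assumes "balanced_map K A B G \<phi>" and "s \<in> carrier (tensor_group K A B)" "t \<in> carrier (tensor_group K A B)"
  shows "tensor_lift G \<phi> (s \<oplus>\<^bsub>tensor_group K A B\<^esub> t) = tensor_lift G \<phi> s \<oplus>\<^bsub>G\<^esub> tensor_lift G \<phi> t"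
  using balanced_map.lift_hom[OF assms(1)] assms(2,3) by (auto simp: hom_def)

lemma lift_add:
  assumes "balanced_map K A B G \<phi>" "balanced_map K A B G \<psi>" "balanced_map K A B G \<chi>"
    and "\<And>a b. \<lbrakk>a \<in> carrier A; b \<in> carrier B\<rbrakk> \<Longrightarrow> \<chi> a b = \<phi> a b \<oplus>\<^bsub>G\<^esub> \<psi> a b"
    and "t \<in> carrier (tensor_group K A B)"
  shows "tensor_lift G \<chi> t = tensor_lift G \<phi> t \<oplus>\<^bsub>G\<^esub> tensor_lift G \<psi> t"
proof -
  interpret G: abelian_group G by (rule balanced_abelian_group[OF assms(1)])
  have "(\<lambda>t. tensor_lift G \<phi> t \<oplus>\<^bsub>G\<^esub> tensor_lift G \<psi> t) \<in> hom (add_monoid (tensor_group K A B)) (add_monoid G)"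
    by (rule homI)
      (simp_all add: lift_closed[OF assms(1)] lift_closed[OF assms(2)] lift_plus[OF assms(1)]
        lift_plus[OF assms(2)] G.a_ac)
  from lift_unique[OF assms(3) this _ assms(5)] show ?thesis
    by (simp add: balanced_map.lift_pure[OF assms(1)] balanced_map.lift_pure[OF assms(2)] assms(4))
qed

lemma balanced_post:
  assumes "balanced_map K A B G \<phi>" "abelian_group G'" "f \<in> hom (add_monoid G) (add_monoid G')"
  shows "balanced_map K A B G' (\<lambda>a b. f (\<phi> a b))"
proof -
  interpret balanced_map K A B G \<phi> by fact
  interpret G': abelian_group G' by fact
  show ?thesis using assms(3)
    by unfold_locales (auto simp: hom_def closed add_left add_right bal A.ract_closed B.ract_closed Pi_iff)
qed

text \<open>Moves an additive map inside a Sweedler sum. It holds because the composite is additive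
  and has the right values on pure tensors. The later computations with coproducts rest on
  it.\<close>

lemma lift_post:
  assumes "balanced_map K A B G \<phi>" "abelian_group G'" "f \<in> hom (add_monoid G) (add_monoid G')"
    and "t \<in> carrier (tensor_group K A B)"
  shows "f (tensor_lift G \<phi> t) = tensor_lift G' (\<lambda>a b. f (\<phi> a b)) t"
proof -
  have "(\<lambda>t. f (tensor_lift G \<phi> t)) \<in> hom (add_monoid (tensor_group K A B)) (add_monoid G')"
    using balanced_map.lift_hom[OF assms(1)] assms(3) by (auto simp: hom_def Pi_iff)
  from lift_unique[OF balanced_post[OF assms(1-3)] this _ assms(4)] show ?thesis
    by (simp add: balanced_map.lift_pure[OF assms(1)])
qed

lemma balanced_comp:
  assumes "balanced_map K A B G \<phi>" "right_module K A'" "right_module K B'"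
    and f: "f \<in> rmod_hom K A' A" and g: "g \<in> rmod_hom K B' B"
  shows "balanced_map K A' B' G (\<lambda>a b. \<phi> (f a) (g b))"
proof -
  interpret balanced_map K A B G \<phi> by fact
  interpret A': right_module K A' by fact
  interpret B': right_module K B' by fact
  show ?thesis using f g
    by unfold_locales (auto simp: rmod_hom_def hom_def closed add_left add_right bal Pi_iff)
qed

text \<open>\<open>tensor\<close> and \<open>tensor_group\<close> are records of different types
  with the same additive structure. A lift sees only the carrier, zero and addition of its target,
  so both targets give the same lift.\<close>

lemma tensor_simps [simp]:
  "carrier (tensor K A B) = carrier (tensor_group K A B)"
  "\<zero>\<^bsub>tensor K A B\<^esub> = \<zero>\<^bsub>tensor_group K A B\<^esub>"
  "x \<oplus>\<^bsub>tensor K A B\<^esub> y = x \<oplus>\<^bsub>tensor_group K A B\<^esub> y"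
  "tensor_lift (tensor K A B) = tensor_lift (tensor_group K A B)"
  by (simp_all add: tensor_def ring.defs fun_eq_iff tensor_lift_def frag_eval_def finsum_def add_pow_def
      finprod_def int_pow_def
      nat_pow_def Let_def m_inv_def cong: if_cong)

lemma hom_tensor [simp]:
  "hom (add_monoid (tensor K A B)) G = hom (add_monoid (tensor_group K A B)) G"
  "hom G (add_monoid (tensor K A B)) = hom G (add_monoid (tensor_group K A B))"
  by (simp_all add: hom_def)

lemma tensor_ract:
  "t \<bullet>\<^bsub>tensor K A B\<^esub> c = tensor_lift (tensor_group K A B) (\<lambda>a b. pure K A B (a \<bullet>\<^bsub>A\<^esub> c) b) t"
  by (simp add: tensor_def ring.defs)

lemma abelian_group_eqI:
  assumes "abelian_group G" "carrier G' = carrier G" "\<zero>\<^bsub>G'\<^esub> = \<zero>\<^bsub>G\<^esub>" "\<And>x y. x \<oplus>\<^bsub>G'\<^esub> y = x \<oplus>\<^bsub>G\<^esub> y"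
  shows "abelian_group G'"
proof -
  interpret G: abelian_group G by fact
  show ?thesis
  proof (rule abelian_groupI)
    fix x assume "x \<in> carrier G'"
    then show "\<exists>y\<in>carrier G'. y \<oplus>\<^bsub>G'\<^esub> x = \<zero>\<^bsub>G'\<^esub>"
      using assms G.l_neg by (intro bexI[of _ "\<ominus>\<^bsub>G\<^esub> x"]) auto
  qed (auto simp: assms G.a_ac)
qed

section \<open>The scalar action on a tensor product\<close>

context tensor_pair begin

lemma abelian_group_tensor: "abelian_group (tensor K A B)"
  by (rule abelian_group_eqI[OF tensor_abelian_group]) simp_all

lemma pure_balanced_tensor: "balanced_map K A B (tensor K A B) (pure K A B)"
proof -
  interpret balanced_map K A B T "pure K A B" by (rule pure_balanced)
  interpret P: abelian_group "tensor K A B" by (rule abelian_group_tensor)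
  show ?thesis by unfold_locales (simp_all add: closed add_left add_right bal)
qed

text \<open>Commutativity of \<open>K\<close> lets the fixed scalar \<open>c\<close> pass the scalar
  that is being balanced.\<close>

lemma balanced_scale:
  assumes "cring K" "balanced_map K A B G \<phi>" "c \<in> carrier K"
  shows "balanced_map K A B G (\<lambda>a b. \<phi> (a \<bullet>\<^bsub>A\<^esub> c) b)"
proof -
  interpret K: cring K by fact
  interpret balanced_map K A B G \<phi> by fact
  have "a \<bullet>\<^bsub>A\<^esub> d \<bullet>\<^bsub>A\<^esub> c = a \<bullet>\<^bsub>A\<^esub> c \<bullet>\<^bsub>A\<^esub> d" if "a \<in> carrier A" "d \<in> carrier K" for a d
    using that assms(3) by (metis A.ract_assoc K.m_comm)
  then show ?thesis using assms(3)
    by unfold_locales (simp_all add: closed add_left add_right bal A.ract_closed B.ract_closed A.ract_add_left)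
qed

lemma lift_ract:
  assumes "cring K" "balanced_map K A B G \<phi>" "c \<in> carrier K" "t \<in> carrier T"
  shows "tensor_lift G \<phi> (t \<bullet>\<^bsub>tensor K A B\<^esub> c) = tensor_lift G (\<lambda>a b. \<phi> (a \<bullet>\<^bsub>A\<^esub> c) b) t"
proof -
  interpret balanced_map K A B G \<phi> by fact
  have b: "balanced_map K A B T (\<lambda>a b. pure K A B (a \<bullet>\<^bsub>A\<^esub> c) b)"
    by (rule balanced_scale[OF assms(1) pure_balanced assms(3)])
  show ?thesis unfolding tensor_ract
    by (subst lift_post[OF b G.abelian_group_axioms lift_hom assms(4)],
        rule lift_cong[OF balanced_post[OF b G.abelian_group_axioms lift_hom]])
      (simp_all add: lift_pure A.ract_closed assms)
qed

lemma pure_ract: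
  assumes "cring K" "a \<in> carrier A" "b \<in> carrier B" "c \<in> carrier K"
  shows "pure K A B a b \<bullet>\<^bsub>tensor K A B\<^esub> c = pure K A B (a \<bullet>\<^bsub>A\<^esub> c) b"
  unfolding tensor_ract
  using balanced_map.lift_pure[OF balanced_scale[OF assms(1) pure_balanced]] assms by simp

lemma ract_hom:
  assumes "cring K" "c \<in> carrier K"
  shows "(\<lambda>t. t \<bullet>\<^bsub>tensor K A B\<^esub> c) \<in> hom (add_monoid T) (add_monoid T)"
  unfolding tensor_ract
  by (rule balanced_map.lift_hom[OF balanced_scale[OF assms(1) pure_balanced assms(2)]])

text \<open>For fixed scalars, both sides of the axioms in the scalar variable are additive in the
  tensor, so \<open>tensor_ext\<close> leaves only pure tensors, where the axioms of
  \<open>A\<close> apply.\<close>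

lemma right_module_tensor:
  assumes "cring K" shows "right_module K (tensor K A B)"
proof -
  interpret K: cring K by fact
  interpret P: abelian_group "tensor K A B" by (rule abelian_group_tensor)
  interpret p: balanced_map K A B T "pure K A B" by (rule pure_balanced)
  note h = ract_hom[OF assms]
  have cl: "t \<bullet>\<^bsub>tensor K A B\<^esub> c \<in> carrier T" if "t \<in> carrier T" "c \<in> carrier K" for t c
    using h[OF that(2)] that(1) by (auto simp: hom_def)
  have add: "(s \<oplus>\<^bsub>T\<^esub> t) \<bullet>\<^bsub>tensor K A B\<^esub> c = s \<bullet>\<^bsub>tensor K A B\<^esub> c \<oplus>\<^bsub>T\<^esub> t \<bullet>\<^bsub>tensor K A B\<^esub> c"
    if "s \<in> carrier T" "t \<in> carrier T" "c \<in> carrier K" for s t c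
    using h[OF that(3)] that(1,2) by (auto simp: hom_def)
  show ?thesis
  proof unfold_locales
    fix t r s assume t: "t \<in> carrier (tensor K A B)" and rs: "r \<in> carrier K" "s \<in> carrier K"
    have "(\<lambda>t. t \<bullet>\<^bsub>tensor K A B\<^esub> r \<oplus>\<^bsub>T\<^esub> t \<bullet>\<^bsub>tensor K A B\<^esub> s) \<in> hom (add_monoid T) (add_monoid T)"
      by (rule homI) (simp_all add: cl add rs T.a_ac)
    from tensor_ext[OF tensor_abelian_group h this]
    show "t \<bullet>\<^bsub>tensor K A B\<^esub> (r \<oplus>\<^bsub>K\<^esub> s) = t \<bullet>\<^bsub>tensor K A B\<^esub> r \<oplus>\<^bsub>tensor K A B\<^esub> t \<bullet>\<^bsub>tensor K A B\<^esub> s"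
      using t rs by (simp add: pure_ract assms A.ract_add_right p.add_left A.ract_closed)
    have "(\<lambda>t. t \<bullet>\<^bsub>tensor K A B\<^esub> r \<bullet>\<^bsub>tensor K A B\<^esub> s) \<in> hom (add_monoid T) (add_monoid T)"
      by (rule homI) (simp_all add: cl add rs)
    from tensor_ext[OF tensor_abelian_group h this]
    show "t \<bullet>\<^bsub>tensor K A B\<^esub> (r \<otimes>\<^bsub>K\<^esub> s) = t \<bullet>\<^bsub>tensor K A B\<^esub> r \<bullet>\<^bsub>tensor K A B\<^esub> s"
      using t rs by (simp add: pure_ract assms A.ract_assoc A.ract_closed)
  next
    fix t assume t: "t \<in> carrier (tensor K A B)"
    have "(\<lambda>t. t) \<in> hom (add_monoid T) (add_monoid T)" by (rule homI) simp_all
    from tensor_ext[OF tensor_abelian_group h this, of "\<one>\<^bsub>K\<^esub>" t]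
    show "t \<bullet>\<^bsub>tensor K A B\<^esub> \<one>\<^bsub>K\<^esub> = t"
      using t by (simp add: pure_ract assms A.ract_one)
  qed (use cl add in simp_all)
qed

end

section \<open>Trilinear maps and the two bracketings of a triple tensor product\<close>

text \<open>Trilinearity is split into two families of balanced maps, one with the first and one
  with the last argument fixed. These are the inner lifts of the two bracketings A (x) (B (x) C) and
  (A (x) B) (x) C.\<close>

locale trilinear_map = A: right_module K A + B: right_module K B + C: right_module K C +
    G: abelian_group G + K: cring K
  for K :: "('k, 'x) ring_scheme" and A :: "('k, 'a) rmodule" and B :: "('k, 'b) rmodule"
    and C :: "('k, 'c) rmodule" and G :: "('g, 'y) ring_scheme" and \<phi> :: "'a \<Rightarrow> 'b \<Rightarrow> 'c \<Rightarrow> 'g" +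
  assumes fix_left: "a \<in> carrier A \<Longrightarrow> balanced_map K B C G (\<phi> a)"
    and fix_right: "c \<in> carrier C \<Longrightarrow> balanced_map K A B G (\<lambda>a b. \<phi> a b c)"

lemma trilinear_mapI:
  assumes "cring K" "right_module K A" "right_module K B" "right_module K C" "abelian_group G"
    and closed: "\<And>a b c. \<lbrakk>a \<in> carrier A; b \<in> carrier B; c \<in> carrier C\<rbrakk> \<Longrightarrow> \<phi> a b c \<in> carrier G"
    and add_1: "\<And>a a' b c. \<lbrakk>a \<in> carrier A; a' \<in> carrier A; b \<in> carrier B; c \<in> carrier C\<rbrakk> \<Longrightarrow>
      \<phi> (a \<oplus>\<^bsub>A\<^esub> a') b c = \<phi> a b c \<oplus>\<^bsub>G\<^esub> \<phi> a' b c"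
    and add_2: "\<And>a b b' c. \<lbrakk>a \<in> carrier A; b \<in> carrier B; b' \<in> carrier B; c \<in> carrier C\<rbrakk> \<Longrightarrow>
      \<phi> a (b \<oplus>\<^bsub>B\<^esub> b') c = \<phi> a b c \<oplus>\<^bsub>G\<^esub> \<phi> a b' c"
    and add_3: "\<And>a b c c'. \<lbrakk>a \<in> carrier A; b \<in> carrier B; c \<in> carrier C; c' \<in> carrier C\<rbrakk> \<Longrightarrow>
      \<phi> a b (c \<oplus>\<^bsub>C\<^esub> c') = \<phi> a b c \<oplus>\<^bsub>G\<^esub> \<phi> a b c'"
    and bal_12: "\<And>a b c k. \<lbrakk>a \<in> carrier A; b \<in> carrier B; c \<in> carrier C; k \<in> carrier K\<rbrakk> \<Longrightarrow>
      \<phi> (a \<bullet>\<^bsub>A\<^esub> k) b c = \<phi> a (b \<bullet>\<^bsub>B\<^esub> k) c"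
    and bal_23: "\<And>a b c k. \<lbrakk>a \<in> carrier A; b \<in> carrier B; c \<in> carrier C; k \<in> carrier K\<rbrakk> \<Longrightarrow>
      \<phi> a (b \<bullet>\<^bsub>B\<^esub> k) c = \<phi> a b (c \<bullet>\<^bsub>C\<^esub> k)"
  shows "trilinear_map K A B C G \<phi>"
  by (intro trilinear_map.intro trilinear_map_axioms.intro balanced_map.intro balanced_map_axioms.intro assms(1-5))
    (simp_all only: closed add_1 add_2 add_3 bal_12 bal_23)

context trilinear_map
begin

lemma add_1: "\<lbrakk>a \<in> carrier A; a' \<in> carrier A; b \<in> carrier B; c \<in> carrier C\<rbrakk> \<Longrightarrow>
    \<phi> (a \<oplus>\<^bsub>A\<^esub> a') b c = \<phi> a b c \<oplus>\<^bsub>G\<^esub> \<phi> a' b c"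
  by (rule balanced_map.add_left[OF fix_right])

lemma add_3: "\<lbrakk>a \<in> carrier A; b \<in> carrier B; c \<in> carrier C; c' \<in> carrier C\<rbrakk> \<Longrightarrow>
    \<phi> a b (c \<oplus>\<^bsub>C\<^esub> c') = \<phi> a b c \<oplus>\<^bsub>G\<^esub> \<phi> a b c'"
  by (rule balanced_map.add_right[OF fix_left])

lemma bal_12: "\<lbrakk>a \<in> carrier A; b \<in> carrier B; c \<in> carrier C; k \<in> carrier K\<rbrakk> \<Longrightarrow>
    \<phi> (a \<bullet>\<^bsub>A\<^esub> k) b c = \<phi> a (b \<bullet>\<^bsub>B\<^esub> k) c"
  by (rule balanced_map.bal[OF fix_right])

lemma bal_23: "\<lbrakk>a \<in> carrier A; b \<in> carrier B; c \<in> carrier C; k \<in> carrier K\<rbrakk> \<Longrightarrow>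
    \<phi> a (b \<bullet>\<^bsub>B\<^esub> k) c = \<phi> a b (c \<bullet>\<^bsub>C\<^esub> k)"
  by (rule balanced_map.bal[OF fix_left])

interpretation AB: tensor_pair K A B by unfold_locales
interpretation BC: tensor_pair K B C by unfold_locales

lemma right_module_AB: "right_module K (tensor K A B)"
  by (rule AB.right_module_tensor[OF K.cring_axioms])

lemma right_module_BC: "right_module K (tensor K B C)"
  by (rule BC.right_module_tensor[OF K.cring_axioms])

lemma lift_right: "balanced_map K A (tensor K B C) G (\<lambda>a t. tensor_lift G (\<phi> a) t)"
proof -
  interpret P: right_module K "tensor K B C" by (rule right_module_BC)
  show ?thesis
  proof (rule balanced_map.intro[OF A.right_module_axioms P.right_module_axioms G.abelian_group_axioms],
      rule balanced_map_axioms.intro; unfold tensor_simps)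
    fix a a' t assume h: "a \<in> carrier A" "a' \<in> carrier A" "t \<in> carrier (tensor_group K B C)"
    show "tensor_lift G (\<phi> (a \<oplus>\<^bsub>A\<^esub> a')) t = tensor_lift G (\<phi> a) t \<oplus>\<^bsub>G\<^esub> tensor_lift G (\<phi> a') t"
      by (rule lift_add[OF fix_left fix_left fix_left]) (simp_all only: add_1 h A.M.a_closed)
  next
    fix a t c assume h: "a \<in> carrier A" "t \<in> carrier (tensor_group K B C)" "c \<in> carrier K"
    \<comment> \<open>The scalar on B (x) C acts through its first factor B, so balancing between
      the first two arguments is enough.\<close>
    show "tensor_lift G (\<phi> (a \<bullet>\<^bsub>A\<^esub> c)) t = tensor_lift G (\<phi> a) (t \<bullet>\<^bsub>tensor K B C\<^esub> c)"
      unfolding BC.lift_ract[OF K.cring_axioms fix_left[OF h(1)] h(3,2)]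
      by (rule lift_cong[OF fix_left]) (simp_all only: h A.ract_closed bal_12)
  next
    fix a t assume h: "a \<in> carrier A" "t \<in> carrier (tensor_group K B C)"
    show "tensor_lift G (\<phi> a) t \<in> carrier G" by (rule lift_closed[OF fix_left[OF h(1)] h(2)])
    fix t' assume "t' \<in> carrier (tensor_group K B C)"
    then show "tensor_lift G (\<phi> a) (t \<oplus>\<^bsub>tensor_group K B C\<^esub> t') = tensor_lift G (\<phi> a) t \<oplus>\<^bsub>G\<^esub> tensor_lift G (\<phi> a) t'"
      by (rule lift_plus[OF fix_left[OF h(1)] h(2)])
  qed
qed

lemma lift_left: "balanced_map K (tensor K A B) C G (\<lambda>t c. tensor_lift G (\<lambda>a b. \<phi> a b c) t)"
proof -
  interpret P: right_module K "tensor K A B" by (rule right_module_AB)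
  show ?thesis
  proof (rule balanced_map.intro[OF P.right_module_axioms C.right_module_axioms G.abelian_group_axioms],
      rule balanced_map_axioms.intro; unfold tensor_simps)
    fix t c c' assume h: "t \<in> carrier (tensor_group K A B)" "c \<in> carrier C" "c' \<in> carrier C"
    show "tensor_lift G (\<lambda>a b. \<phi> a b (c \<oplus>\<^bsub>C\<^esub> c')) t
      = tensor_lift G (\<lambda>a b. \<phi> a b c) t \<oplus>\<^bsub>G\<^esub> tensor_lift G (\<lambda>a b. \<phi> a b c') t"
      by (rule lift_add[OF fix_right fix_right fix_right]) (simp_all only: add_3 h C.M.a_closed)
  next
    fix t c k assume h: "t \<in> carrier (tensor_group K A B)" "c \<in> carrier C" "k \<in> carrier K"
    \<comment> \<open>Here the scalar acts on A, the far factor of A (x) B. It has to cross from A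
      to B and then from B to C.\<close>
    show "tensor_lift G (\<lambda>a b. \<phi> a b c) (t \<bullet>\<^bsub>tensor K A B\<^esub> k) = tensor_lift G (\<lambda>a b. \<phi> a b (c \<bullet>\<^bsub>C\<^esub> k)) t"
      unfolding AB.lift_ract[OF K.cring_axioms fix_right[OF h(2)] h(3,1)]
      by (rule lift_cong[OF AB.balanced_scale[OF K.cring_axioms fix_right]])
        (simp_all only: h bal_12 bal_23)
  next
    fix t c assume h: "t \<in> carrier (tensor_group K A B)" "c \<in> carrier C"
    show "tensor_lift G (\<lambda>a b. \<phi> a b c) t \<in> carrier G" by (rule lift_closed[OF fix_right[OF h(2)] h(1)])
    fix t' assume "t' \<in> carrier (tensor_group K A B)"
    then show "tensor_lift G (\<lambda>a b. \<phi> a b c) (t \<oplus>\<^bsub>tensor_group K A B\<^esub> t')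
        = tensor_lift G (\<lambda>a b. \<phi> a b c) t \<oplus>\<^bsub>G\<^esub> tensor_lift G (\<lambda>a b. \<phi> a b c) t'"
      by (rule lift_plus[OF fix_right[OF h(2)] h(1)])
  qed
qed

lemma trilinear_pure:
  "trilinear_map K A B C (tensor K A (tensor K B C)) (\<lambda>a b c. pure K A (tensor K B C) a (pure K B C b c))"
proof -
  interpret BC': right_module K "tensor K B C" by (rule right_module_BC)
  interpret ABC: tensor_pair K A "tensor K B C" by unfold_locales
  interpret p: balanced_map K A "tensor K B C" "tensor K A (tensor K B C)" "pure K A (tensor K B C)"
    by (rule ABC.pure_balanced_tensor)
  interpret q: balanced_map K B C "tensor K B C" "pure K B C" by (rule BC.pure_balanced_tensor)
  show ?thesis
    by (rule trilinear_mapI[OF K.cring_axioms A.right_module_axioms B.right_module_axioms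
          C.right_module_axioms p.G.abelian_group_axioms])
      (simp_all only: q.closed p.closed p.add_left p.add_right q.add_left q.add_right q.bal p.bal
        BC.pure_ract[OF K.cring_axioms] B.ract_closed flip: q.bal)
qed

text \<open>The lift over the right bracketing sends a (x) (b (x) c) to \<open>\<phi> a b c\<close>.
  Pushing it through the two nested lifts in \<open>tensor_assoc\<close> therefore leaves the lift
  over the left bracketing.\<close>

lemma lift_assoc:
  assumes t: "t \<in> carrier (tensor_group K (tensor K A B) C)"
  shows "tensor_lift G (\<lambda>a. tensor_lift G (\<phi> a)) (tensor_assoc K A B C t)
    = tensor_lift G (\<lambda>s c. tensor_lift G (\<lambda>a b. \<phi> a b c) s) t"
proof -
  let ?P = "tensor K A (tensor K B C)" and ?f = "tensor_lift G (\<lambda>a. tensor_lift G (\<phi> a))"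
  interpret p: trilinear_map K A B C ?P "\<lambda>a b c. pure K A (tensor K B C) a (pure K B C b c)"
    by (rule trilinear_pure)
  have f: "?f \<in> hom (add_monoid ?P) (add_monoid G)"
    using balanced_map.lift_hom[OF lift_right] by (simp only: hom_tensor)
  have pure: "?f (pure K A (tensor K B C) a (pure K B C b c)) = \<phi> a b c"
    if "a \<in> carrier A" "b \<in> carrier B" "c \<in> carrier C" for a b c
    using that by (simp only: balanced_map.lift_pure[OF lift_right] BC.pure_closed tensor_simps
        balanced_map.lift_pure[OF fix_left])
  have eq: "?f (tensor_lift ?P (\<lambda>a b. pure K A (tensor K B C) a (pure K B C b c)) s)
      = tensor_lift G (\<lambda>a b. \<phi> a b c) s" if s: "s \<in> carrier (tensor K A B)" and c: "c \<in> carrier C" for s c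
    unfolding lift_post[OF p.fix_right[OF c] G.abelian_group_axioms f s[unfolded tensor_simps]]
    by (rule lift_cong[OF balanced_post[OF p.fix_right[OF c] G.abelian_group_axioms f]])
      (use pure c s in \<open>simp_all only: tensor_simps\<close>)
  show ?thesis unfolding tensor_assoc_def lift_post[OF p.lift_left G.abelian_group_axioms f t]
    by (rule lift_cong[OF balanced_post[OF p.lift_left G.abelian_group_axioms f] eq t])
qed

end

lemma lift_tensor_map:
  assumes "balanced_map K C D G \<phi>" "right_module K A" "right_module K B"
    and f: "f \<in> rmod_hom K A C" and g: "g \<in> rmod_hom K B D"
    and t: "t \<in> carrier (tensor_group K A B)"
  shows "tensor_lift G \<phi> (tensor_map K C D f g t) = tensor_lift G (\<lambda>a b. \<phi> (f a) (g b)) t"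
proof -
  interpret balanced_map K C D G \<phi> by fact
  interpret CD: tensor_pair K C D by unfold_locales
  have p: "balanced_map K A B (tensor_group K C D) (\<lambda>a b. pure K C D (f a) (g b))"
    by (rule balanced_comp[OF CD.pure_balanced assms(2-5)])
  show ?thesis unfolding tensor_map_def tensor_simps
    by (subst lift_post[OF p G.abelian_group_axioms lift_hom t],
        rule lift_cong[OF balanced_post[OF p G.abelian_group_axioms lift_hom] _ t])
      (use f g in \<open>auto simp: lift_pure rmod_hom_def hom_def Pi_iff\<close>)
qed

section \<open>Carriers and operations of the derived modules\<close>

lemma ring_extend_simps [simp]:
  "carrier (ring.extend (ring.truncate M) ext) = carrier M"
  "\<zero>\<^bsub>ring.extend (ring.truncate M) ext\<^esub> = \<zero>\<^bsub>M\<^esub>"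
  "x \<oplus>\<^bsub>ring.extend (ring.truncate M) ext\<^esub> y = x \<oplus>\<^bsub>M\<^esub> y"
  "carrier (ring.extend N ext) = carrier N"
  "\<zero>\<^bsub>ring.extend N ext\<^esub> = \<zero>\<^bsub>N\<^esub>"
  "x' \<oplus>\<^bsub>ring.extend N ext\<^esub> y' = x' \<oplus>\<^bsub>N\<^esub> y'"
  by (simp_all add: ring.defs)

lemma restrict_scalars_simps [simp]:
  "carrier (restrict_scalars H M) = carrier M"
  "\<zero>\<^bsub>restrict_scalars H M\<^esub> = \<zero>\<^bsub>M\<^esub>"
  "x \<oplus>\<^bsub>restrict_scalars H M\<^esub> y = x \<oplus>\<^bsub>M\<^esub> y"
  "x \<bullet>\<^bsub>restrict_scalars H M\<^esub> c = x \<bullet>\<^bsub>M\<^esub> unit_map H c"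
  unfolding restrict_scalars_def by (simp_all add: ring.defs)

lemma regular_simps [simp]:
  "carrier (regular R) = carrier R"
  "\<zero>\<^bsub>regular R\<^esub> = \<zero>\<^bsub>R\<^esub>"
  "x \<oplus>\<^bsub>regular R\<^esub> y = x \<oplus>\<^bsub>R\<^esub> y"
  "x \<bullet>\<^bsub>regular R\<^esub> r = x \<otimes>\<^bsub>R\<^esub> r"
  unfolding regular_def by (simp_all add: ring.defs)

lemma hspace_simps [simp]:
  "carrier (hspace H) = carrier H"
  "\<zero>\<^bsub>hspace H\<^esub> = \<zero>\<^bsub>H\<^esub>"
  "x \<oplus>\<^bsub>hspace H\<^esub> y = x \<oplus>\<^bsub>H\<^esub> y"
  "x \<bullet>\<^bsub>hspace H\<^esub> c = x \<otimes>\<^bsub>H\<^esub> unit_map H c"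
  by (simp_all add: hspace_def)

lemma tensor_module_simps [simp]:
  "carrier (tensor_module K H M N) = carrier (tensor_group K (restrict_scalars H M) (restrict_scalars H N))"
  "\<zero>\<^bsub>tensor_module K H M N\<^esub> = \<zero>\<^bsub>tensor_group K (restrict_scalars H M) (restrict_scalars H N)\<^esub>"
  "s \<oplus>\<^bsub>tensor_module K H M N\<^esub> t = s \<oplus>\<^bsub>tensor_group K (restrict_scalars H M) (restrict_scalars H N)\<^esub> t"
  by (simp_all add: tensor_module_def Let_def)

lemma tensor_module_ract:
  "t \<bullet>\<^bsub>tensor_module K H M N\<^esub> h =
    tensor_lift (tensor_group K (restrict_scalars H M) (restrict_scalars H N)) (\<lambda>x y.
      tensor_lift (tensor_group K (restrict_scalars H M) (restrict_scalars H N)) (\<lambda>a b.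
        pure K (restrict_scalars H M) (restrict_scalars H N) (x \<bullet>\<^bsub>M\<^esub> a) (y \<bullet>\<^bsub>N\<^esub> b)) (comult H h)) t"
  by (simp add: tensor_module_def Let_def ring.defs)

lemma right_module_regular:
  assumes "ring R" shows "right_module R (regular R)"
proof -
  interpret R: ring R by fact
  interpret M: abelian_group "regular R"
    by (rule abelian_group_eqI[OF R.abelian_group_axioms]) simp_all
  show ?thesis by unfold_locales (simp_all add: R.l_distr R.r_distr R.m_assoc)
qed

section \<open>Sweedler calculus\<close>

context hopf_algebra begin

lemma unit_map_closed [simp]: "c \<in> carrier K \<Longrightarrow> unit_map H c \<in> carrier H"
  using unit_map_hom by (auto simp: ring_hom_def)

lemma unit_map_add: "\<lbrakk>c \<in> carrier K; d \<in> carrier K\<rbrakk> \<Longrightarrow>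
    unit_map H (c \<oplus>\<^bsub>K\<^esub> d) = unit_map H c \<oplus>\<^bsub>H\<^esub> unit_map H d"
  using unit_map_hom by (auto simp: ring_hom_def)

lemma unit_map_mult: "\<lbrakk>c \<in> carrier K; d \<in> carrier K\<rbrakk> \<Longrightarrow>
    unit_map H (c \<otimes>\<^bsub>K\<^esub> d) = unit_map H c \<otimes>\<^bsub>H\<^esub> unit_map H d"
  using unit_map_hom by (auto simp: ring_hom_def)

lemma unit_map_one: "unit_map H \<one>\<^bsub>K\<^esub> = \<one>\<^bsub>H\<^esub>"
  using unit_map_hom by (auto simp: ring_hom_def)

lemma counit_closed [simp]: "h \<in> carrier H \<Longrightarrow> counit H h \<in> carrier K"
  using counit_hom by (auto simp: ring_hom_def)

lemma counit_add: "\<lbrakk>g \<in> carrier H; h \<in> carrier H\<rbrakk> \<Longrightarrow>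
    counit H (g \<oplus>\<^bsub>H\<^esub> h) = counit H g \<oplus>\<^bsub>K\<^esub> counit H h"
  using counit_hom by (auto simp: ring_hom_def)

lemma counit_scale: "\<lbrakk>h \<in> carrier H; c \<in> carrier K\<rbrakk> \<Longrightarrow>
    counit H (h \<otimes>\<^bsub>H\<^esub> unit_map H c) = counit H h \<otimes>\<^bsub>K\<^esub> c"
  using counit_hom by (simp add: ring_hom_def counit_unit_map)

lemma antipode_closed [simp]: "h \<in> carrier H \<Longrightarrow> antipode H h \<in> carrier H"
  using antipode_linear by (auto simp: rmod_hom_def hom_def)

lemma antipode_add: "\<lbrakk>g \<in> carrier H; h \<in> carrier H\<rbrakk> \<Longrightarrow>
    antipode H (g \<oplus>\<^bsub>H\<^esub> h) = antipode H g \<oplus>\<^bsub>H\<^esub> antipode H h"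
  using antipode_linear by (auto simp: rmod_hom_def hom_def)

lemma antipode_scale: "\<lbrakk>h \<in> carrier H; c \<in> carrier K\<rbrakk> \<Longrightarrow>
    antipode H (h \<otimes>\<^bsub>H\<^esub> unit_map H c) = antipode H h \<otimes>\<^bsub>H\<^esub> unit_map H c"
  using antipode_linear by (auto simp: rmod_hom_def)

lemma comult_closed: "h \<in> carrier H \<Longrightarrow> comult H h \<in> carrier (tensor_group K (hspace H) (hspace H))"
  using comult_linear by (auto simp: rmod_hom_def hom_def)

lemma right_module_restrict:
  assumes "right_module H M" shows "right_module K (restrict_scalars H M)"
proof -
  interpret M: right_module H M by fact
  interpret M': abelian_group "restrict_scalars H M"
    by (rule abelian_group_eqI[OF M.M.abelian_group_axioms]) simp_all
  show ?thesis
    by unfold_locales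
      (simp_all add: M.ract_closed M.ract_add_left M.ract_add_right M.ract_assoc M.ract_one
        unit_map_add unit_map_mult unit_map_one)
qed

lemma right_module_hspace: "right_module K (hspace H)"
  unfolding hspace_def by (rule right_module_restrict[OF right_module_regular[OF H.ring_axioms]])

lemma rmod_hom_restrict:
  assumes "f \<in> rmod_hom H M N"
  shows "f \<in> rmod_hom K (restrict_scalars H M) (restrict_scalars H N)"
  using assms by (auto simp: rmod_hom_def hom_def)

lemma ract_rmod_hom:
  assumes "right_module H M" "x \<in> carrier M"
  shows "(\<lambda>a. x \<bullet>\<^bsub>M\<^esub> a) \<in> rmod_hom K (hspace H) (restrict_scalars H M)"
proof -
  interpret M: right_module H M by fact
  show ?thesis using assms(2)
    by (auto simp: rmod_hom_def hom_def M.ract_closed M.ract_add_right M.ract_assoc)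
qed

text \<open>This is what justifies writing sum of \<open>\<phi>\<close>(h1, h2, h3). The two sides
  are the lifts of \<open>\<phi>\<close> over the two bracketings, evaluated on the two sides of
  \<open>coassoc\<close>; \<open>lift_assoc\<close> matches them.\<close>

lemma sweedler_coassoc:
  assumes "trilinear_map K (hspace H) (hspace H) (hspace H) G \<phi>" and h: "h \<in> carrier H"
  shows "tensor_lift G (\<lambda>a b. tensor_lift G (\<phi> a) (comult H b)) (comult H h)
    = tensor_lift G (\<lambda>a b. tensor_lift G (\<lambda>a' b'. \<phi> a' b' b) (comult H a)) (comult H h)"
proof -
  let ?V = "hspace H" let ?VV = "tensor K ?V ?V"
  interpret trilinear_map K ?V ?V ?V G \<phi> by fact
  have id: "(\<lambda>a. a) \<in> rmod_hom K ?V ?V" by (simp add: rmod_hom_def hom_def)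
  note V = right_module_hspace
  interpret p: tensor_pair K ?VV ?V
    by (intro tensor_pair.intro right_module_AB V)
  have c: "tensor_map K ?VV ?V (comult H) (\<lambda>a. a) (comult H h) \<in> carrier (tensor_group K ?VV ?V)"
    unfolding tensor_map_def tensor_simps
    by (rule lift_closed[OF balanced_comp[OF p.pure_balanced V V comult_linear id] comult_closed[OF h]])
  have "tensor_lift G (\<lambda>a b. tensor_lift G (\<lambda>a' b'. \<phi> a' b' b) (comult H a)) (comult H h)
      = tensor_lift G (\<lambda>s c. tensor_lift G (\<lambda>a b. \<phi> a b c) s)
          (tensor_map K ?VV ?V (comult H) (\<lambda>a. a) (comult H h))"
    by (rule lift_tensor_map[OF lift_left V V comult_linear id comult_closed[OF h], symmetric])
  also have "\<dots> = tensor_lift G (\<lambda>a. tensor_lift G (\<phi> a))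
      (tensor_assoc K ?V ?V ?V (tensor_map K ?VV ?V (comult H) (\<lambda>a. a) (comult H h)))"
    by (rule lift_assoc[OF c, symmetric])
  also have "\<dots> = tensor_lift G (\<lambda>a. tensor_lift G (\<phi> a)) (tensor_map K ?V ?VV (\<lambda>a. a) (comult H) (comult H h))"
    by (simp only: coassoc[OF h])
  also have "\<dots> = tensor_lift G (\<lambda>a b. tensor_lift G (\<phi> a) (comult H b)) (comult H h)"
    by (rule lift_tensor_map[OF lift_right V V id comult_linear comult_closed[OF h]])
  finally show ?thesis by simp
qed

end

section \<open>Linear forms on vector spaces\<close>

text \<open>Zorn's lemma gives a subspace W maximal among those that omit \<open>x0\<close>. Then M
  is the direct sum of W and the line through \<open>x0\<close>, and the form is the coordinate
  along \<open>x0\<close>.\<close>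

lemma (in right_module) exists_functional:
  assumes "field R" and x0: "x0 \<in> carrier M" "x0 \<noteq> \<zero>\<^bsub>M\<^esub>"
  obtains \<phi> where "\<And>x. x \<in> carrier M \<Longrightarrow> \<phi> x \<in> carrier R"
    and "\<And>x y. \<lbrakk>x \<in> carrier M; y \<in> carrier M\<rbrakk> \<Longrightarrow> \<phi> (x \<oplus>\<^bsub>M\<^esub> y) = \<phi> x \<oplus>\<^bsub>R\<^esub> \<phi> y"
    and "\<And>x c. \<lbrakk>x \<in> carrier M; c \<in> carrier R\<rbrakk> \<Longrightarrow> \<phi> (x \<bullet>\<^bsub>M\<^esub> c) = \<phi> x \<otimes>\<^bsub>R\<^esub> c"
    and "\<phi> x0 = \<one>\<^bsub>R\<^esub>"
proof -
  interpret R: field R by fact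
  define S where "S = {W. W \<subseteq> carrier M \<and> \<zero>\<^bsub>M\<^esub> \<in> W \<and> (\<forall>x\<in>W. \<forall>y\<in>W. x \<oplus>\<^bsub>M\<^esub> y \<in> W) \<and>
    (\<forall>x\<in>W. \<forall>c\<in>carrier R. x \<bullet>\<^bsub>M\<^esub> c \<in> W) \<and> x0 \<notin> W}"
  have "\<exists>W\<in>S. \<forall>W'\<in>S. W \<subseteq> W' \<longrightarrow> W' = W"
  proof (rule subset_Zorn_nonempty)
    have "{\<zero>\<^bsub>M\<^esub>} \<in> S" using x0 by (auto simp: S_def zero_ract)
    then show "S \<noteq> {}" by blast
  next
    fix C assume C: "C \<noteq> {}" "subset.chain S C"
    then have CS: "C \<subseteq> S" and tot: "\<And>U V. \<lbrakk>U \<in> C; V \<in> C\<rbrakk> \<Longrightarrow> U \<subseteq> V \<or> V \<subseteq> U"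
      by (auto simp: subset.chain_def)
    have "x \<oplus>\<^bsub>M\<^esub> y \<in> \<Union>C" if xy: "x \<in> \<Union>C" "y \<in> \<Union>C" for x y
    proof -
      obtain U V where UV: "U \<in> C" "V \<in> C" "x \<in> U" "y \<in> V" using xy by blast
      then obtain W where "W \<in> C" "x \<in> W" "y \<in> W" using tot[of U V] by blast
      then show ?thesis using CS unfolding S_def by blast
    qed
    then show "\<Union>C \<in> S" using C(1) CS unfolding S_def by blast
  qed
  then obtain W where W: "W \<in> S" and max: "\<And>W'. \<lbrakk>W' \<in> S; W \<subseteq> W'\<rbrakk> \<Longrightarrow> W' = W" by blast
  have Wsub: "W \<subseteq> carrier M" and Wz: "\<zero>\<^bsub>M\<^esub> \<in> W" and Wadd: "\<And>x y. \<lbrakk>x \<in> W; y \<in> W\<rbrakk> \<Longrightarrow> x \<oplus>\<^bsub>M\<^esub> y \<in> W"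
    and Wr: "\<And>x c. \<lbrakk>x \<in> W; c \<in> carrier R\<rbrakk> \<Longrightarrow> x \<bullet>\<^bsub>M\<^esub> c \<in> W" and Wx0: "x0 \<notin> W"
    using W by (auto simp: S_def)
  have Wneg: "\<ominus>\<^bsub>M\<^esub> x \<in> W" if "x \<in> W" for x
    using Wr[OF that, of "\<ominus>\<^bsub>R\<^esub> \<one>\<^bsub>R\<^esub>"] ract_minus_one[of x] that Wsub by auto
  note [simp] = ract_closed
  \<comment> \<open>If x lies outside W, then W + xK is strictly larger, so by maximality it
    contains \<open>x0\<close>. The resulting equation is solved for x.\<close>
  have ex: "\<exists>c\<in>carrier R. \<exists>w\<in>W. x = w \<oplus>\<^bsub>M\<^esub> x0 \<bullet>\<^bsub>M\<^esub> c" if x: "x \<in> carrier M" for x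
  proof (cases "x \<in> W")
    case True
    then show ?thesis using x x0 by (intro bexI[of _ "\<zero>\<^bsub>R\<^esub>"] bexI[of _ x]) (simp_all add: ract_zero)
  next
    case False
    let ?W = "{w \<oplus>\<^bsub>M\<^esub> x \<bullet>\<^bsub>M\<^esub> c | w c. w \<in> W \<and> c \<in> carrier R}"
    have "x0 \<in> ?W"
    proof (rule ccontr)
      assume n: "x0 \<notin> ?W"
      have sub: "W \<subseteq> ?W"
      proof
        fix w assume "w \<in> W"
        then show "w \<in> ?W" using x Wsub
          by (intro CollectI exI[of _ w] exI[of _ "\<zero>\<^bsub>R\<^esub>"]) (auto simp: ract_zero)
      qed
      have "x \<in> ?W" using x Wz
        by (intro CollectI exI[of _ "\<zero>\<^bsub>M\<^esub>"] exI[of _ "\<one>\<^bsub>R\<^esub>"]) (simp add: ract_one)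
      moreover have "?W \<in> S" unfolding S_def
      proof (rule CollectI, intro conjI ballI n)
        show "?W \<subseteq> carrier M" using Wsub x by auto
        show "\<zero>\<^bsub>M\<^esub> \<in> ?W" using sub Wz by blast
      next
        fix y z assume "y \<in> ?W" "z \<in> ?W"
        then obtain v w c d where h: "v \<in> W" "w \<in> W" "c \<in> carrier R" "d \<in> carrier R"
          "y = v \<oplus>\<^bsub>M\<^esub> x \<bullet>\<^bsub>M\<^esub> c" "z = w \<oplus>\<^bsub>M\<^esub> x \<bullet>\<^bsub>M\<^esub> d" by blast
        moreover have "v \<in> carrier M" "w \<in> carrier M" using h Wsub by auto
        ultimately show "y \<oplus>\<^bsub>M\<^esub> z \<in> ?W" using x
          by (intro CollectI exI[of _ "v \<oplus>\<^bsub>M\<^esub> w"] exI[of _ "c \<oplus>\<^bsub>R\<^esub> d"])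
            (simp add: Wadd ract_add_right M.a_ac)
      next
        fix y d assume "y \<in> ?W" and d: "d \<in> carrier R"
        then obtain w c where h: "w \<in> W" "c \<in> carrier R" "y = w \<oplus>\<^bsub>M\<^esub> x \<bullet>\<^bsub>M\<^esub> c" by blast
        moreover have "w \<in> carrier M" using h Wsub by auto
        ultimately show "y \<bullet>\<^bsub>M\<^esub> d \<in> ?W" using x d
          by (intro CollectI exI[of _ "w \<bullet>\<^bsub>M\<^esub> d"] exI[of _ "c \<otimes>\<^bsub>R\<^esub> d"])
            (simp add: Wr ract_add_left ract_assoc)
      qed
      ultimately show False using max sub False by blast
    qed
    then obtain w c where h: "w \<in> W" "c \<in> carrier R" "x0 = w \<oplus>\<^bsub>M\<^esub> x \<bullet>\<^bsub>M\<^esub> c" by blast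
    have w: "w \<in> carrier M" using h Wsub by auto
    \<comment> \<open>With c = 0 the equation would put \<open>x0\<close> in W.\<close>
    have "c \<noteq> \<zero>\<^bsub>R\<^esub>" using h w x Wx0 by (auto simp: ract_zero)
    then have c: "inv\<^bsub>R\<^esub> c \<in> carrier R" "c \<otimes>\<^bsub>R\<^esub> inv\<^bsub>R\<^esub> c = \<one>\<^bsub>R\<^esub>" using h(2) by (simp_all add: R.field_Units)
    have "x0 \<bullet>\<^bsub>M\<^esub> inv\<^bsub>R\<^esub> c = w \<bullet>\<^bsub>M\<^esub> inv\<^bsub>R\<^esub> c \<oplus>\<^bsub>M\<^esub> x \<bullet>\<^bsub>M\<^esub> (c \<otimes>\<^bsub>R\<^esub> inv\<^bsub>R\<^esub> c)"
      using h(3) w x h(2) c(1) by (simp add: ract_add_left ract_assoc)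
    then have "x = \<ominus>\<^bsub>M\<^esub> (w \<bullet>\<^bsub>M\<^esub> inv\<^bsub>R\<^esub> c) \<oplus>\<^bsub>M\<^esub> x0 \<bullet>\<^bsub>M\<^esub> inv\<^bsub>R\<^esub> c"
      using w x c by (simp add: ract_one M.r_neg1)
    then show ?thesis using c(1) Wneg[OF Wr[OF h(1) c(1)]] by blast
  qed
  \<comment> \<open>Two different coefficients would put a nonzero multiple of \<open>x0\<close>,
    hence \<open>x0\<close> itself, in W.\<close>
  have uniq: "c = d" if h: "c \<in> carrier R" "d \<in> carrier R" "v \<in> W" "w \<in> W"
    "v \<oplus>\<^bsub>M\<^esub> x0 \<bullet>\<^bsub>M\<^esub> c = w \<oplus>\<^bsub>M\<^esub> x0 \<bullet>\<^bsub>M\<^esub> d" for c d v w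
  proof (rule ccontr)
    assume "c \<noteq> d"
    then have nz: "c \<ominus>\<^bsub>R\<^esub> d \<noteq> \<zero>\<^bsub>R\<^esub>" using h R.eq_if_diff_zero by blast
    let ?e = "c \<ominus>\<^bsub>R\<^esub> d"
    have e: "?e \<in> carrier R" "inv\<^bsub>R\<^esub> ?e \<in> carrier R" "?e \<otimes>\<^bsub>R\<^esub> inv\<^bsub>R\<^esub> ?e = \<one>\<^bsub>R\<^esub>"
      using nz h by (simp_all add: R.field_Units)
    have vw: "v \<in> carrier M" "w \<in> carrier M" using h Wsub by auto
    have "x0 \<bullet>\<^bsub>M\<^esub> c = x0 \<bullet>\<^bsub>M\<^esub> (?e \<oplus>\<^bsub>R\<^esub> d)"
      using h by (simp add: a_minus_def R.a_assoc R.l_neg)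
    also have "\<dots> = x0 \<bullet>\<^bsub>M\<^esub> ?e \<oplus>\<^bsub>M\<^esub> x0 \<bullet>\<^bsub>M\<^esub> d" using h e x0 by (simp add: ract_add_right)
    finally have "(v \<oplus>\<^bsub>M\<^esub> x0 \<bullet>\<^bsub>M\<^esub> ?e) \<oplus>\<^bsub>M\<^esub> x0 \<bullet>\<^bsub>M\<^esub> d = w \<oplus>\<^bsub>M\<^esub> x0 \<bullet>\<^bsub>M\<^esub> d"
      using h(5) vw x0 e h(2) by (simp add: M.a_assoc)
    then have "v \<oplus>\<^bsub>M\<^esub> x0 \<bullet>\<^bsub>M\<^esub> ?e = w" using vw x0 e(1) h(2) by simp
    then have "x0 \<bullet>\<^bsub>M\<^esub> ?e = \<ominus>\<^bsub>M\<^esub> v \<oplus>\<^bsub>M\<^esub> w" using vw x0 e(1) by (auto simp: M.r_neg1)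
    then have "x0 \<bullet>\<^bsub>M\<^esub> ?e \<in> W" using h Wadd Wneg by simp
    then have "x0 \<bullet>\<^bsub>M\<^esub> ?e \<bullet>\<^bsub>M\<^esub> inv\<^bsub>R\<^esub> ?e \<in> W" by (rule Wr[OF _ e(2)])
    moreover have "x0 \<bullet>\<^bsub>M\<^esub> ?e \<bullet>\<^bsub>M\<^esub> inv\<^bsub>R\<^esub> ?e = x0"
      unfolding ract_assoc[OF x0(1) e(1,2), symmetric] e(3) by (rule ract_one[OF x0(1)])
    ultimately show False using Wx0 by simp
  qed
  define l where "l x = (THE c. c \<in> carrier R \<and> (\<exists>w\<in>W. x = w \<oplus>\<^bsub>M\<^esub> x0 \<bullet>\<^bsub>M\<^esub> c))" for x
  have l_eq: "l x = c" if "c \<in> carrier R" "w \<in> W" "x = w \<oplus>\<^bsub>M\<^esub> x0 \<bullet>\<^bsub>M\<^esub> c" for x c w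
    unfolding l_def using that uniq by (intro the_equality) blast+
  have l: "l x \<in> carrier R \<and> (\<exists>w\<in>W. x = w \<oplus>\<^bsub>M\<^esub> x0 \<bullet>\<^bsub>M\<^esub> l x)" if "x \<in> carrier M" for x
    using ex[OF that] l_eq by metis
  show thesis
  proof (rule that[of l])
    show "l x \<in> carrier R" if "x \<in> carrier M" for x using l[OF that] by blast
    show "l (x \<oplus>\<^bsub>M\<^esub> y) = l x \<oplus>\<^bsub>R\<^esub> l y" if xy: "x \<in> carrier M" "y \<in> carrier M" for x y
    proof -
      obtain v w where h: "v \<in> W" "w \<in> W" "x = v \<oplus>\<^bsub>M\<^esub> x0 \<bullet>\<^bsub>M\<^esub> l x" "y = w \<oplus>\<^bsub>M\<^esub> x0 \<bullet>\<^bsub>M\<^esub> l y"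
        using l xy by blast
      have c: "v \<in> carrier M" "w \<in> carrier M" "l x \<in> carrier R" "l y \<in> carrier R" using h Wsub l xy by auto
      have "x \<oplus>\<^bsub>M\<^esub> y = (v \<oplus>\<^bsub>M\<^esub> x0 \<bullet>\<^bsub>M\<^esub> l x) \<oplus>\<^bsub>M\<^esub> (w \<oplus>\<^bsub>M\<^esub> x0 \<bullet>\<^bsub>M\<^esub> l y)"
        using h by metis
      also have "\<dots> = (v \<oplus>\<^bsub>M\<^esub> w) \<oplus>\<^bsub>M\<^esub> x0 \<bullet>\<^bsub>M\<^esub> (l x \<oplus>\<^bsub>R\<^esub> l y)"
        using c x0 by (simp add: ract_add_right M.a_ac)
      finally show ?thesis using c h by (intro l_eq[of _ "v \<oplus>\<^bsub>M\<^esub> w"]) (simp_all add: Wadd)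
    qed
    show "l (x \<bullet>\<^bsub>M\<^esub> c) = l x \<otimes>\<^bsub>R\<^esub> c" if xc: "x \<in> carrier M" "c \<in> carrier R" for x c
    proof -
      obtain v where h: "v \<in> W" "x = v \<oplus>\<^bsub>M\<^esub> x0 \<bullet>\<^bsub>M\<^esub> l x" using l xc by blast
      have c: "v \<in> carrier M" "l x \<in> carrier R" using h Wsub l xc by auto
      have "x \<bullet>\<^bsub>M\<^esub> c = (v \<oplus>\<^bsub>M\<^esub> x0 \<bullet>\<^bsub>M\<^esub> l x) \<bullet>\<^bsub>M\<^esub> c" using h by metis
      also have "\<dots> = v \<bullet>\<^bsub>M\<^esub> c \<oplus>\<^bsub>M\<^esub> x0 \<bullet>\<^bsub>M\<^esub> (l x \<otimes>\<^bsub>R\<^esub> c)"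
        using c x0 xc by (simp add: ract_add_left ract_assoc)
      finally show ?thesis using c h xc by (intro l_eq[of _ "v \<bullet>\<^bsub>M\<^esub> c"]) (simp_all add: Wr)
    qed
    show "l x0 = \<one>\<^bsub>R\<^esub>" using x0 Wz by (intro l_eq[of _ "\<zero>\<^bsub>M\<^esub>"]) (simp_all add: ract_one)
  qed
qed

section \<open>The map from \<open>X \<otimes> H\<close> to \<open>H\<close> given by a linear form on \<open>X\<close>\<close>

text \<open>\<open>M\<close> is a copy of the regular module, on a type that need not be the one of \<open>H\<close>, and \<open>e\<close> is
  its generator; \<open>L\<close> is a linear form on \<open>X\<close> followed by \<open>unit_map H\<close>. The class \<open>\<X>\<close> provides the
  module axioms for \<open>X \<otimes> M\<close>, so these are assumed.\<close>

locale hopf_tensor_free = hopf_algebra K H + X: right_module H X + M: right_module H M +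
    TM: right_module H "tensor_module K H X M"
  for K :: "('k, 'x) ring_scheme" and H :: "('k, 'h) hopf"
    and X :: "('h, 'm) rmodule" and M :: "('h, 'n) rmodule" +
  fixes i :: "'n \<Rightarrow> 'h" and e :: 'n and L :: "'m \<Rightarrow> 'h"
  assumes i_hom: "i \<in> rmod_hom H M (regular H)" and i_inj: "inj_on i (carrier M)"
    and e_closed: "e \<in> carrier M" and i_e: "i e = \<one>\<^bsub>H\<^esub>"
    and L_closed [simp]: "x \<in> carrier X \<Longrightarrow> L x \<in> carrier H"
    and L_add: "\<lbrakk>x \<in> carrier X; y \<in> carrier X\<rbrakk> \<Longrightarrow> L (x \<oplus>\<^bsub>X\<^esub> y) = L x \<oplus>\<^bsub>H\<^esub> L y"
    and L_scale: "\<lbrakk>x \<in> carrier X; c \<in> carrier K\<rbrakk> \<Longrightarrow> L (x \<bullet>\<^bsub>X\<^esub> unit_map H c) = L x \<otimes>\<^bsub>H\<^esub> unit_map H c"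
begin

abbreviation "V \<equiv> hspace H"
abbreviation "XK \<equiv> restrict_scalars H X"
abbreviation "MK \<equiv> restrict_scalars H M"
abbreviation "TG \<equiv> tensor_group K XK MK"
abbreviation tp (infixl "\<odot>" 75) where "x \<odot> m \<equiv> pure K XK MK x m"

lemma V_module: "right_module K V" by (rule right_module_hspace)
lemma XK_module: "right_module K XK" by (rule right_module_restrict[OF X.right_module_axioms])
lemma MK_module: "right_module K MK" by (rule right_module_restrict[OF M.right_module_axioms])

sublocale T: tensor_pair K XK MK
  by (intro tensor_pair.intro XK_module MK_module)

lemma i_closed [simp]: "m \<in> carrier M \<Longrightarrow> i m \<in> carrier H"
  using i_hom by (auto simp: rmod_hom_def hom_def)

lemma i_ract: "\<lbrakk>m \<in> carrier M; h \<in> carrier H\<rbrakk> \<Longrightarrow> i (m \<bullet>\<^bsub>M\<^esub> h) = i m \<otimes>\<^bsub>H\<^esub> h"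
  using i_hom by (auto simp: rmod_hom_def)

text \<open>Both sides have image \<open>i m\<close> in H, and \<open>i\<close> is injective. So
  \<open>e\<close> generates M, and every pure tensor has the form x (x) e h.\<close>

lemma e_ract: "m \<in> carrier M \<Longrightarrow> e \<bullet>\<^bsub>M\<^esub> i m = m"
  by (rule inj_onD[OF i_inj]) (simp_all add: i_ract e_closed i_e M.ract_closed)

lemma i_e_ract: "h \<in> carrier H \<Longrightarrow> i (e \<bullet>\<^bsub>M\<^esub> h) = h"
  by (simp add: i_ract e_closed i_e)

lemma pure_add_left: "\<lbrakk>x \<in> carrier X; x' \<in> carrier X; m \<in> carrier M\<rbrakk> \<Longrightarrow>
    (x \<oplus>\<^bsub>X\<^esub> x') \<odot> m = x \<odot> m \<oplus>\<^bsub>TG\<^esub> x' \<odot> m"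
  by (rule balanced_map.add_left[OF T.pure_balanced, unfolded restrict_scalars_simps])

lemma pure_add_right: "\<lbrakk>x \<in> carrier X; m \<in> carrier M; m' \<in> carrier M\<rbrakk> \<Longrightarrow>
    x \<odot> (m \<oplus>\<^bsub>M\<^esub> m') = x \<odot> m \<oplus>\<^bsub>TG\<^esub> x \<odot> m'"
  by (rule balanced_map.add_right[OF T.pure_balanced, unfolded restrict_scalars_simps])

lemma pure_bal: "\<lbrakk>x \<in> carrier X; m \<in> carrier M; c \<in> carrier K\<rbrakk> \<Longrightarrow>
    (x \<bullet>\<^bsub>X\<^esub> unit_map H c) \<odot> m = x \<odot> (m \<bullet>\<^bsub>M\<^esub> unit_map H c)"
  by (rule balanced_map.bal[OF T.pure_balanced, unfolded restrict_scalars_simps])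

lemma pure_closed: "\<lbrakk>x \<in> carrier X; m \<in> carrier M\<rbrakk> \<Longrightarrow> x \<odot> m \<in> carrier TG"
  by (rule T.pure_closed[unfolded restrict_scalars_simps])

lemma ract_balanced:
  assumes "x \<in> carrier X" "m \<in> carrier M"
  shows "balanced_map K V V TG (\<lambda>a b. (x \<bullet>\<^bsub>X\<^esub> a) \<odot> (m \<bullet>\<^bsub>M\<^esub> b))"
  by (rule balanced_comp[OF T.pure_balanced V_module V_module ract_rmod_hom[OF X.right_module_axioms assms(1)]
        ract_rmod_hom[OF M.right_module_axioms assms(2)]])

text \<open>Well-definedness of the diagonal action: with t a coproduct, this is the integrand in
  the definition of \<open>tensor_module\<close>. Once it is balanced, the action can be evaluated
  on pure tensors.\<close>

lemma lift_ract_balanced: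
  assumes t: "t \<in> carrier (tensor_group K V V)"
  shows "balanced_map K XK MK TG (\<lambda>x y. tensor_lift TG (\<lambda>a b. (x \<bullet>\<^bsub>X\<^esub> a) \<odot> (y \<bullet>\<^bsub>M\<^esub> b)) t)"
proof (rule balanced_map.intro[OF XK_module MK_module T.tensor_abelian_group], rule balanced_map_axioms.intro;
    unfold restrict_scalars_simps)
  note [simp] = X.ract_closed M.ract_closed X.ract_add_left M.ract_add_left
  fix x y assume x: "x \<in> carrier X" and y: "y \<in> carrier M"
  show "tensor_lift TG (\<lambda>a b. (x \<bullet>\<^bsub>X\<^esub> a) \<odot> (y \<bullet>\<^bsub>M\<^esub> b)) t \<in> carrier TG"
    by (rule lift_closed[OF ract_balanced[OF x y] t])
  show "tensor_lift TG (\<lambda>a b. ((x \<oplus>\<^bsub>X\<^esub> x') \<bullet>\<^bsub>X\<^esub> a) \<odot> (y \<bullet>\<^bsub>M\<^esub> b)) t =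
      tensor_lift TG (\<lambda>a b. (x \<bullet>\<^bsub>X\<^esub> a) \<odot> (y \<bullet>\<^bsub>M\<^esub> b)) t \<oplus>\<^bsub>TG\<^esub>
      tensor_lift TG (\<lambda>a b. (x' \<bullet>\<^bsub>X\<^esub> a) \<odot> (y \<bullet>\<^bsub>M\<^esub> b)) t" if x': "x' \<in> carrier X" for x'
    by (rule lift_add[OF ract_balanced[OF x y] ract_balanced[OF x' y] ract_balanced[OF X.M.a_closed[OF x x'] y] _ t])
      (simp add: x y x' pure_add_left)
  show "tensor_lift TG (\<lambda>a b. (x \<bullet>\<^bsub>X\<^esub> a) \<odot> ((y \<oplus>\<^bsub>M\<^esub> y') \<bullet>\<^bsub>M\<^esub> b)) t =
      tensor_lift TG (\<lambda>a b. (x \<bullet>\<^bsub>X\<^esub> a) \<odot> (y \<bullet>\<^bsub>M\<^esub> b)) t \<oplus>\<^bsub>TG\<^esub>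
      tensor_lift TG (\<lambda>a b. (x \<bullet>\<^bsub>X\<^esub> a) \<odot> (y' \<bullet>\<^bsub>M\<^esub> b)) t" if y': "y' \<in> carrier M" for y'
    by (rule lift_add[OF ract_balanced[OF x y] ract_balanced[OF x y'] ract_balanced[OF x M.M.a_closed[OF y y']] _ t])
      (simp add: x y y' pure_add_right)
  show "tensor_lift TG (\<lambda>a b. (x \<bullet>\<^bsub>X\<^esub> unit_map H c \<bullet>\<^bsub>X\<^esub> a) \<odot> (y \<bullet>\<^bsub>M\<^esub> b)) t =
      tensor_lift TG (\<lambda>a b. (x \<bullet>\<^bsub>X\<^esub> a) \<odot> (y \<bullet>\<^bsub>M\<^esub> unit_map H c \<bullet>\<^bsub>M\<^esub> b)) t" if c: "c \<in> carrier K" for c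
  proof (rule lift_cong[OF ract_balanced _ t], unfold hspace_simps)
    fix a b assume h: "a \<in> carrier H" "b \<in> carrier H"
    \<comment> \<open>Scalars are central in H, so c moves behind a and b, next to the tensor
      sign.\<close>
    have "x \<bullet>\<^bsub>X\<^esub> unit_map H c \<bullet>\<^bsub>X\<^esub> a = x \<bullet>\<^bsub>X\<^esub> a \<bullet>\<^bsub>X\<^esub> unit_map H c"
      using h x c by (simp add: unit_map_central flip: X.ract_assoc)
    moreover have "y \<bullet>\<^bsub>M\<^esub> unit_map H c \<bullet>\<^bsub>M\<^esub> b = y \<bullet>\<^bsub>M\<^esub> b \<bullet>\<^bsub>M\<^esub> unit_map H c"
      using h y c by (simp add: unit_map_central flip: M.ract_assoc)
    ultimately show "(x \<bullet>\<^bsub>X\<^esub> unit_map H c \<bullet>\<^bsub>X\<^esub> a) \<odot> (y \<bullet>\<^bsub>M\<^esub> b) = (x \<bullet>\<^bsub>X\<^esub> a) \<odot> (y \<bullet>\<^bsub>M\<^esub> unit_map H c \<bullet>\<^bsub>M\<^esub> b)"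
      using h x y c by (simp add: pure_bal)
  qed (use x y c in simp_all)
qed

lemma pure_ract:
  assumes "x \<in> carrier X" "m \<in> carrier M" "h \<in> carrier H"
  shows "(x \<odot> m) \<bullet>\<^bsub>tensor_module K H X M\<^esub> h
    = tensor_lift TG (\<lambda>a b. (x \<bullet>\<^bsub>X\<^esub> a) \<odot> (m \<bullet>\<^bsub>M\<^esub> b)) (comult H h)"
  unfolding tensor_module_ract
  by (rule balanced_map.lift_pure[OF lift_ract_balanced[OF comult_closed[OF assms(3)]], unfolded restrict_scalars_simps])
    (rule assms)+

text \<open>The antipode and counit axioms evaluate lifts. Balanced integrands are what allows
  \<open>lift_post\<close> to apply these axioms underneath further additive maps.\<close>

lemma antipode_left_balanced: "balanced_map K V V H (\<lambda>a b. antipode H a \<otimes>\<^bsub>H\<^esub> b)"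
  by (rule balanced_map.intro[OF V_module V_module H.abelian_group_axioms], rule balanced_map_axioms.intro;
      unfold hspace_simps)
    (simp_all add: antipode_add antipode_scale H.l_distr H.r_distr H.m_assoc unit_map_central)

lemma antipode_right_balanced: "balanced_map K V V H (\<lambda>a b. a \<otimes>\<^bsub>H\<^esub> antipode H b)"
  by (rule balanced_map.intro[OF V_module V_module H.abelian_group_axioms], rule balanced_map_axioms.intro;
      unfold hspace_simps)
    (simp_all add: antipode_add antipode_scale H.l_distr H.r_distr H.m_assoc unit_map_central)

lemma counit_left_balanced: "balanced_map K V V H (\<lambda>a b. unit_map H (counit H a) \<otimes>\<^bsub>H\<^esub> b)"
proof (rule balanced_map.intro[OF V_module V_module H.abelian_group_axioms], rule balanced_map_axioms.intro;
    unfold hspace_simps)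
  fix a b c assume h: "a \<in> carrier H" "b \<in> carrier H" "c \<in> carrier K"
  show "unit_map H (counit H (a \<otimes>\<^bsub>H\<^esub> unit_map H c)) \<otimes>\<^bsub>H\<^esub> b
      = unit_map H (counit H a) \<otimes>\<^bsub>H\<^esub> (b \<otimes>\<^bsub>H\<^esub> unit_map H c)"
    using h by (simp add: counit_scale unit_map_mult H.m_assoc unit_map_central[of c b])
qed (simp_all add: counit_add unit_map_add H.l_distr H.r_distr)

text \<open>\<open>coact x m\<close> is \<open>\<Sum> \<lambda>(x S(h\<^sub>1)) h\<^sub>2\<close> for \<open>m = e h\<close> and \<open>L = unit_map H \<circ> \<lambda>\<close>.\<close>

definition coact :: "'m \<Rightarrow> 'n \<Rightarrow> 'h" where
  "coact x m = tensor_lift H (\<lambda>a b. L (x \<bullet>\<^bsub>X\<^esub> antipode H a) \<otimes>\<^bsub>H\<^esub> b) (comult H (i m))"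

text \<open>Separating x from the two legs of the coproduct makes the integrand of
  \<open>coact\<close> trilinear. A scalar leaves \<open>L\<close> by \<open>L_scale\<close> and
  passes b by centrality.\<close>

lemma L_trilinear: "trilinear_map K XK V V H (\<lambda>x a b. L (x \<bullet>\<^bsub>X\<^esub> antipode H a) \<otimes>\<^bsub>H\<^esub> b)"
proof (rule trilinear_mapI[OF K.cring_axioms XK_module V_module V_module H.abelian_group_axioms];
    unfold restrict_scalars_simps hspace_simps)
  note [simp] = X.ract_closed
  fix x a b c assume h: "x \<in> carrier X" "a \<in> carrier H" "b \<in> carrier H" "c \<in> carrier K"
  show "L (x \<bullet>\<^bsub>X\<^esub> unit_map H c \<bullet>\<^bsub>X\<^esub> antipode H a) \<otimes>\<^bsub>H\<^esub> b
      = L (x \<bullet>\<^bsub>X\<^esub> antipode H (a \<otimes>\<^bsub>H\<^esub> unit_map H c)) \<otimes>\<^bsub>H\<^esub> b"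
    using h by (simp add: antipode_scale unit_map_central flip: X.ract_assoc)
  show "L (x \<bullet>\<^bsub>X\<^esub> antipode H (a \<otimes>\<^bsub>H\<^esub> unit_map H c)) \<otimes>\<^bsub>H\<^esub> b
      = L (x \<bullet>\<^bsub>X\<^esub> antipode H a) \<otimes>\<^bsub>H\<^esub> (b \<otimes>\<^bsub>H\<^esub> unit_map H c)"
    using h by (simp add: antipode_scale X.ract_assoc L_scale H.m_assoc unit_map_central)
qed (simp_all add: X.ract_closed X.ract_add_left X.ract_add_right L_add antipode_add H.l_distr H.r_distr)

text \<open>\<open>coact\<close> is the right-bracketed lift of a trilinear map, precomposed with
  the identity on X and with the coproduct after \<open>i\<close>; both are K-linear.\<close>

lemma coact_balanced: "balanced_map K XK MK H coact"
proof -
  have id: "(\<lambda>x. x) \<in> rmod_hom K XK XK" by (simp add: rmod_hom_def hom_def)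
  have i: "i \<in> rmod_hom K MK V"
    unfolding hspace_def by (rule rmod_hom_restrict[OF i_hom])
  have "(\<lambda>m. comult H (i m)) \<in> rmod_hom K MK (tensor K V V)"
    using i comult_linear by (auto simp: rmod_hom_def hom_def Pi_iff)
  from balanced_comp[OF trilinear_map.lift_right[OF L_trilinear] XK_module MK_module id this]
  show ?thesis by (simp add: coact_def[abs_def])
qed

abbreviation "\<Phi> \<equiv> tensor_lift H coact"

lemma \<Phi>_hom: "\<Phi> \<in> hom (add_monoid TG) (add_monoid H)"
  by (rule balanced_map.lift_hom[OF coact_balanced])

lemma \<Phi>_pure: "\<lbrakk>x \<in> carrier X; m \<in> carrier M\<rbrakk> \<Longrightarrow> \<Phi> (x \<odot> m) = coact x m"
  by (rule balanced_map.lift_pure[OF coact_balanced, unfolded restrict_scalars_simps])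

text \<open>The left side is the sum of L(x h1 S(h2)) h3. The antipode axiom contracts the first two
  legs to a counit, and the counit axiom leaves L(x) h.\<close>

lemma \<Phi>_generator:
  assumes x: "x \<in> carrier X" and h: "h \<in> carrier H"
  shows "\<Phi> ((x \<odot> e) \<bullet>\<^bsub>tensor_module K H X M\<^esub> h) = L x \<otimes>\<^bsub>H\<^esub> h"
proof -
  note [simp] = X.ract_closed M.ract_closed
  let ?\<psi> = "\<lambda>a a' b. L (x \<bullet>\<^bsub>X\<^esub> (a \<otimes>\<^bsub>H\<^esub> antipode H a')) \<otimes>\<^bsub>H\<^esub> b"
  have tri: "trilinear_map K V V V H ?\<psi>"
    by (rule trilinear_mapI[OF K.cring_axioms V_module V_module V_module H.abelian_group_axioms];
        unfold hspace_simps)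
      (simp_all add: x X.ract_add_left X.ract_add_right L_add antipode_add H.l_distr H.r_distr
        antipode_scale X.ract_assoc L_scale H.m_assoc unit_map_central)
  have inner: "tensor_lift H (\<lambda>a' b'. ?\<psi> a' b' b) (comult H a)
      = L x \<otimes>\<^bsub>H\<^esub> (unit_map H (counit H a) \<otimes>\<^bsub>H\<^esub> b)" if a: "a \<in> carrier H" and b: "b \<in> carrier H" for a b
  proof -
    \<comment> \<open>The product a1 S(a2) is contracted inside \<open>L\<close>; the scalar it
      leaves comes out by \<open>L_scale\<close>.\<close>
    have "(\<lambda>z. L (x \<bullet>\<^bsub>X\<^esub> z) \<otimes>\<^bsub>H\<^esub> b) \<in> hom (add_monoid H) (add_monoid H)"
      by (rule homI) (simp_all add: x b X.ract_add_right L_add H.l_distr)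
    from lift_post[OF antipode_right_balanced H.abelian_group_axioms this comult_closed[OF a]]
    show ?thesis by (simp add: antipode_right a b x L_scale H.m_assoc)
  qed
  have lx: "(\<lambda>z. L x \<otimes>\<^bsub>H\<^esub> z) \<in> hom (add_monoid H) (add_monoid H)"
    by (rule homI) (simp_all add: x H.r_distr)
  have "\<Phi> ((x \<odot> e) \<bullet>\<^bsub>tensor_module K H X M\<^esub> h)
      = tensor_lift H (\<lambda>a b. \<Phi> ((x \<bullet>\<^bsub>X\<^esub> a) \<odot> (e \<bullet>\<^bsub>M\<^esub> b))) (comult H h)"
    unfolding pure_ract[OF x e_closed h]
    by (rule lift_post[OF ract_balanced[OF x e_closed] H.abelian_group_axioms \<Phi>_hom comult_closed[OF h]])
  also have "\<dots> = tensor_lift H (\<lambda>a b. tensor_lift H (?\<psi> a) (comult H b)) (comult H h)"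
  proof (rule lift_cong[OF balanced_post[OF ract_balanced[OF x e_closed] H.abelian_group_axioms \<Phi>_hom] _ comult_closed[OF h]];
      unfold hspace_simps)
    fix a b assume ab: "a \<in> carrier H" "b \<in> carrier H"
    have "\<Phi> ((x \<bullet>\<^bsub>X\<^esub> a) \<odot> (e \<bullet>\<^bsub>M\<^esub> b))
        = tensor_lift H (\<lambda>a' b'. L (x \<bullet>\<^bsub>X\<^esub> a \<bullet>\<^bsub>X\<^esub> antipode H a') \<otimes>\<^bsub>H\<^esub> b') (comult H b)"
      using ab x e_closed by (simp add: \<Phi>_pure coact_def i_e_ract)
    also have "\<dots> = tensor_lift H (?\<psi> a) (comult H b)"
      by (rule lift_cong[OF _ _ comult_closed[OF ab(2)]], rule trilinear_map.fix_left[OF L_trilinear])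
        (simp_all add: x ab X.ract_assoc)
    finally show "\<Phi> ((x \<bullet>\<^bsub>X\<^esub> a) \<odot> (e \<bullet>\<^bsub>M\<^esub> b)) = tensor_lift H (?\<psi> a) (comult H b)" .
  qed
  also have "\<dots> = tensor_lift H (\<lambda>a b. tensor_lift H (\<lambda>a' b'. ?\<psi> a' b' b) (comult H a)) (comult H h)"
    by (rule sweedler_coassoc[OF tri h])
  also have "\<dots> = tensor_lift H (\<lambda>a b. L x \<otimes>\<^bsub>H\<^esub> (unit_map H (counit H a) \<otimes>\<^bsub>H\<^esub> b)) (comult H h)"
    by (rule lift_cong[OF balanced_post[OF counit_left_balanced H.abelian_group_axioms lx] _ comult_closed[OF h], symmetric])
      (simp_all add: inner)
  also have "\<dots> = L x \<otimes>\<^bsub>H\<^esub> h"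
    using lift_post[OF counit_left_balanced H.abelian_group_axioms lx comult_closed[OF h]] by (simp add: counit_left[OF h])
  finally show ?thesis .
qed

text \<open>The elements \<open>(x \<otimes> e) h\<close> generate \<open>X \<otimes> M\<close>, since \<open>x \<otimes> e h = \<Sum> (x S(h\<^sub>1) \<otimes> e) h\<^sub>2\<close>.\<close>

lemma pure_generated:
  assumes x: "x \<in> carrier X" and h: "h \<in> carrier H"
  defines "P \<equiv> \<lambda>a b. ((x \<bullet>\<^bsub>X\<^esub> antipode H a) \<odot> e) \<bullet>\<^bsub>tensor_module K H X M\<^esub> b"
  shows "balanced_map K V V TG P" and "x \<odot> (e \<bullet>\<^bsub>M\<^esub> h) = tensor_lift TG P (comult H h)"
proof -
  note [simp] = X.ract_closed M.ract_closed
  \<comment> \<open>The integrand of the triple sum of x S(h1) h2 (x) e h3, evaluated below in both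
    bracketings.\<close>
  let ?\<psi> = "\<lambda>a a' b. (x \<bullet>\<^bsub>X\<^esub> (antipode H a \<otimes>\<^bsub>H\<^esub> a')) \<odot> (e \<bullet>\<^bsub>M\<^esub> b)"
  have tri: "trilinear_map K V V V TG ?\<psi>"
  proof (rule trilinear_mapI[OF K.cring_axioms V_module V_module V_module T.tensor_abelian_group];
        unfold hspace_simps)
    fix a a' b c assume h: "a \<in> carrier H" "a' \<in> carrier H" "b \<in> carrier H" "c \<in> carrier K"
    have "(x \<bullet>\<^bsub>X\<^esub> (antipode H a \<otimes>\<^bsub>H\<^esub> a') \<bullet>\<^bsub>X\<^esub> unit_map H c) \<odot> (e \<bullet>\<^bsub>M\<^esub> b)
        = (x \<bullet>\<^bsub>X\<^esub> (antipode H a \<otimes>\<^bsub>H\<^esub> a')) \<odot> (e \<bullet>\<^bsub>M\<^esub> b \<bullet>\<^bsub>M\<^esub> unit_map H c)"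
      using h x e_closed by (intro pure_bal) simp_all
    then show "(x \<bullet>\<^bsub>X\<^esub> (antipode H a \<otimes>\<^bsub>H\<^esub> (a' \<otimes>\<^bsub>H\<^esub> unit_map H c))) \<odot> (e \<bullet>\<^bsub>M\<^esub> b)
        = (x \<bullet>\<^bsub>X\<^esub> (antipode H a \<otimes>\<^bsub>H\<^esub> a')) \<odot> (e \<bullet>\<^bsub>M\<^esub> (b \<otimes>\<^bsub>H\<^esub> unit_map H c))"
      using h x e_closed by (simp add: H.m_assoc flip: X.ract_assoc M.ract_assoc)
  qed (simp_all add: x e_closed X.ract_add_right M.ract_add_right pure_add_left pure_add_right pure_closed
      antipode_add H.l_distr H.r_distr antipode_scale H.m_assoc unit_map_central)
  have P: "tensor_lift TG (?\<psi> a) (comult H b) = P a b" if "a \<in> carrier H" "b \<in> carrier H" for a b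
  proof -
    \<comment> \<open>Right bracketing: a' and b' are the two legs of b, so the inner sum is the
      diagonal action of b on x S(a) (x) e.\<close>
    have "tensor_lift TG (?\<psi> a) (comult H b)
        = tensor_lift TG (\<lambda>a' b'. (x \<bullet>\<^bsub>X\<^esub> antipode H a \<bullet>\<^bsub>X\<^esub> a') \<odot> (e \<bullet>\<^bsub>M\<^esub> b')) (comult H b)"
      by (rule lift_cong[OF trilinear_map.fix_left[OF tri] _ comult_closed[OF that(2)]])
        (simp_all add: x that X.ract_assoc)
    also have "\<dots> = P a b" unfolding P_def using that x by (simp add: pure_ract e_closed)
    finally show ?thesis .
  qed
  have id: "(\<lambda>x. x) \<in> rmod_hom K V V" by (simp add: rmod_hom_def hom_def)
  note bal = balanced_comp[OF trilinear_map.lift_right[OF tri] V_module V_module id comult_linear]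
  \<comment> \<open>P agrees with a lift of a trilinear map precomposed with the coproduct, and
    inherits balancedness from it.\<close>
  show "balanced_map K V V TG P" by (rule balanced_cong[OF bal]) (simp add: P)
  have inner: "tensor_lift TG (\<lambda>a' b'. ?\<psi> a' b' b) (comult H a)
      = x \<odot> (e \<bullet>\<^bsub>M\<^esub> (unit_map H (counit H a) \<otimes>\<^bsub>H\<^esub> b))" if a: "a \<in> carrier H" and b: "b \<in> carrier H" for a b
  proof -
    \<comment> \<open>Left bracketing: S(a1) a2 contracts to the counit of a, and this scalar then
      crosses the tensor sign.\<close>
    have "(\<lambda>z. (x \<bullet>\<^bsub>X\<^esub> z) \<odot> (e \<bullet>\<^bsub>M\<^esub> b)) \<in> hom (add_monoid H) (add_monoid TG)"
      by (rule homI) (simp_all add: x b e_closed X.ract_add_right pure_add_left pure_closed)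
    from lift_post[OF antipode_left_balanced T.tensor_abelian_group this comult_closed[OF a]]
    have "tensor_lift TG (\<lambda>a' b'. ?\<psi> a' b' b) (comult H a) = (x \<bullet>\<^bsub>X\<^esub> unit_map H (counit H a)) \<odot> (e \<bullet>\<^bsub>M\<^esub> b)"
      by (simp add: antipode_left a)
    also have "\<dots> = x \<odot> (e \<bullet>\<^bsub>M\<^esub> (unit_map H (counit H a) \<otimes>\<^bsub>H\<^esub> b))"
      using a b x e_closed by (simp add: pure_bal unit_map_central flip: M.ract_assoc)
    finally show ?thesis .
  qed
  have xe: "(\<lambda>z. x \<odot> (e \<bullet>\<^bsub>M\<^esub> z)) \<in> hom (add_monoid H) (add_monoid TG)"
    by (rule homI) (simp_all add: x e_closed M.ract_add_right pure_add_right pure_closed)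
  have "x \<odot> (e \<bullet>\<^bsub>M\<^esub> h) = tensor_lift TG (\<lambda>a b. x \<odot> (e \<bullet>\<^bsub>M\<^esub> (unit_map H (counit H a) \<otimes>\<^bsub>H\<^esub> b))) (comult H h)"
    using lift_post[OF counit_left_balanced T.tensor_abelian_group xe comult_closed[OF h]] by (simp add: counit_left[OF h])
  also have "\<dots> = tensor_lift TG (\<lambda>a b. tensor_lift TG (\<lambda>a' b'. ?\<psi> a' b' b) (comult H a)) (comult H h)"
    by (rule lift_cong[OF balanced_post[OF counit_left_balanced T.tensor_abelian_group xe] _ comult_closed[OF h]])
      (simp_all add: inner)
  also have "\<dots> = tensor_lift TG (\<lambda>a b. tensor_lift TG (?\<psi> a) (comult H b)) (comult H h)"
    by (rule sweedler_coassoc[OF tri h, symmetric])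
  also have "\<dots> = tensor_lift TG P (comult H h)"
    by (rule lift_cong[OF bal _ comult_closed[OF h]]) (simp add: P)
  finally show "x \<odot> (e \<bullet>\<^bsub>M\<^esub> h) = tensor_lift TG P (comult H h)" .
qed

text \<open>Both sides are additive in t, so t may be a pure tensor, and
  \<open>pure_generated\<close> rewrites that as a sum of elements (y (x) e) b. On such an element
  both sides equal L(y) b k.\<close>

lemma \<Phi>_ract:
  assumes t: "t \<in> carrier TG" and k: "k \<in> carrier H"
  shows "\<Phi> (t \<bullet>\<^bsub>tensor_module K H X M\<^esub> k) = \<Phi> t \<otimes>\<^bsub>H\<^esub> k"
proof -
  let ?act = "\<lambda>t h. t \<bullet>\<^bsub>tensor_module K H X M\<^esub> h"
  have f: "(\<lambda>t. \<Phi> (?act t k)) \<in> hom (add_monoid TG) (add_monoid H)"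
    using TM.ract_closed TM.ract_add_left k \<Phi>_hom by (auto simp: hom_def Pi_iff)
  have g: "(\<lambda>t. \<Phi> t \<otimes>\<^bsub>H\<^esub> k) \<in> hom (add_monoid TG) (add_monoid H)"
    using k \<Phi>_hom by (auto simp: hom_def Pi_iff H.l_distr)
  show ?thesis
  proof (rule T.tensor_ext[OF H.abelian_group_axioms f g _ t]; unfold restrict_scalars_simps)
    fix x m assume x: "x \<in> carrier X" and m: "m \<in> carrier M"
    let ?P = "\<lambda>a b. ?act ((x \<bullet>\<^bsub>X\<^esub> antipode H a) \<odot> e) b"
    note P = pure_generated[OF x i_closed[OF m]]
    note \<Delta> = comult_closed[OF i_closed[OF m]]
    have xm: "x \<odot> m = tensor_lift TG ?P (comult H (i m))"
      using P(2) by (simp add: e_ract m)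
    have "\<Phi> (?act (tensor_lift TG ?P (comult H (i m))) k)
        = tensor_lift H (\<lambda>a b. \<Phi> (?act (?P a b) k)) (comult H (i m))"
      by (rule lift_post[OF P(1) H.abelian_group_axioms f \<Delta>])
    also have "\<dots> = tensor_lift H (\<lambda>a b. \<Phi> (?P a b) \<otimes>\<^bsub>H\<^esub> k) (comult H (i m))"
    proof (rule lift_cong[OF balanced_post[OF P(1) H.abelian_group_axioms f] _ \<Delta>]; unfold hspace_simps)
      fix a b assume ab: "a \<in> carrier H" "b \<in> carrier H"
      have "(x \<bullet>\<^bsub>X\<^esub> antipode H a) \<odot> e \<in> carrier (tensor_module K H X M)"
        using x ab e_closed by (simp add: pure_closed X.ract_closed)
      \<comment> \<open>Acting by b and then k is acting by the product, so
        \<open>\<Phi>_generator\<close> evaluates both sides. This uses the module axioms assumed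
        for X (x) M.\<close>
      then show "\<Phi> (?act (?P a b) k) = \<Phi> (?P a b) \<otimes>\<^bsub>H\<^esub> k"
        using ab x k by (simp add: \<Phi>_generator X.ract_closed H.m_assoc flip: TM.ract_assoc)
    qed
    also have "\<dots> = \<Phi> (tensor_lift TG ?P (comult H (i m))) \<otimes>\<^bsub>H\<^esub> k"
      by (rule lift_post[OF P(1) H.abelian_group_axioms g \<Delta>, symmetric])
    finally show "\<Phi> (?act (x \<odot> m) k) = \<Phi> (x \<odot> m) \<otimes>\<^bsub>H\<^esub> k" unfolding xm .
  qed
qed

lemma \<Phi>_rmod_hom: "\<Phi> \<in> rmod_hom H (tensor_module K H X M) (regular H)"
  using \<Phi>_hom \<Phi>_ract by (auto simp: rmod_hom_def hom_def)

lemma \<Phi>_surj: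
  assumes "x \<in> carrier X" "L x = \<one>\<^bsub>H\<^esub>"
  shows "\<Phi> ` carrier (tensor_module K H X M) = carrier H"
proof -
  have "h \<in> \<Phi> ` carrier (tensor_module K H X M)" if h: "h \<in> carrier H" for h
  proof (rule image_eqI)
    show "h = \<Phi> ((x \<odot> e) \<bullet>\<^bsub>tensor_module K H X M\<^esub> h)" using assms h by (simp add: \<Phi>_generator)
    show "(x \<odot> e) \<bullet>\<^bsub>tensor_module K H X M\<^esub> h \<in> carrier (tensor_module K H X M)"
      by (rule TM.ract_closed) (simp_all add: pure_closed assms e_closed h)
  qed
  moreover have "\<Phi> t \<in> carrier H" if "t \<in> carrier TG" for t using \<Phi>_hom that by (auto simp: hom_def)
  ultimately show ?thesis by auto
qed

end

section \<open>Torsion classes containing a cover of the regular module\<close>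

lemma rmod_hom_closed: "\<lbrakk>f \<in> rmod_hom R M N; x \<in> carrier M\<rbrakk> \<Longrightarrow> f x \<in> carrier N"
  by (auto simp: rmod_hom_def hom_def)

lemma rmod_hom_add: "\<lbrakk>f \<in> rmod_hom R M N; x \<in> carrier M; y \<in> carrier M\<rbrakk> \<Longrightarrow>
    f (x \<oplus>\<^bsub>M\<^esub> y) = f x \<oplus>\<^bsub>N\<^esub> f y"
  by (auto simp: rmod_hom_def hom_def)

lemma rmod_hom_ract: "\<lbrakk>f \<in> rmod_hom R M N; x \<in> carrier M; r \<in> carrier R\<rbrakk> \<Longrightarrow>
    f (x \<bullet>\<^bsub>M\<^esub> r) = f x \<bullet>\<^bsub>N\<^esub> r"
  by (auto simp: rmod_hom_def)

lemma rmod_homI: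
  assumes "\<And>x. x \<in> carrier M \<Longrightarrow> f x \<in> carrier N"
    and "\<And>x y. \<lbrakk>x \<in> carrier M; y \<in> carrier M\<rbrakk> \<Longrightarrow> f (x \<oplus>\<^bsub>M\<^esub> y) = f x \<oplus>\<^bsub>N\<^esub> f y"
    and "\<And>x r. \<lbrakk>x \<in> carrier M; r \<in> carrier R\<rbrakk> \<Longrightarrow> f (x \<bullet>\<^bsub>M\<^esub> r) = f x \<bullet>\<^bsub>N\<^esub> r"
  shows "f \<in> rmod_hom R M N"
  using assms by (auto simp: rmod_hom_def hom_def)

lemma rmod_hom_zero:
  assumes "right_module R M" "right_module R N" "f \<in> rmod_hom R M N"
  shows "f \<zero>\<^bsub>M\<^esub> = \<zero>\<^bsub>N\<^esub>"
  using assms add_hom_zero[of M N f] by (auto simp: right_module_def rmod_hom_def)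

lemma rmod_hom_compose:
  "\<lbrakk>f \<in> rmod_hom R M N; g \<in> rmod_hom R N P\<rbrakk> \<Longrightarrow> (\<lambda>x. g (f x)) \<in> rmod_hom R M P"
  by (rule rmod_homI) (simp_all add: rmod_hom_closed rmod_hom_add rmod_hom_ract)

text \<open>Meant for X (x) M, which is known directly only as an abelian group. The remaining
  axioms are carried over from the isomorphic object in the class.\<close>

lemma right_module_iso:
  assumes "right_module R M" "abelian_group N" "f \<in> rmod_hom R M N" "bij_betw f (carrier M) (carrier N)"
  shows "right_module R N"
proof -
  interpret M: right_module R M by fact
  interpret N: abelian_group N by fact
  have surj: "\<exists>a\<in>carrier M. x = f a" if "x \<in> carrier N" for x
    using that assms(4) by (auto simp: bij_betw_def)
  note f = rmod_hom_closed[OF assms(3)] rmod_hom_add[OF assms(3), symmetric]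
    rmod_hom_ract[OF assms(3), symmetric]
  show ?thesis
  proof unfold_locales
    fix x assume x: "x \<in> carrier N"
    obtain a where a: "a \<in> carrier M" "x = f a" using surj[OF x] by blast
    show "x \<bullet>\<^bsub>N\<^esub> \<one>\<^bsub>R\<^esub> = x" using a by (simp add: f M.ract_one)
    fix r assume r: "r \<in> carrier R"
    show "x \<bullet>\<^bsub>N\<^esub> r \<in> carrier N" using a r by (simp add: f M.ract_closed)
    show "x \<bullet>\<^bsub>N\<^esub> (r \<oplus>\<^bsub>R\<^esub> s) = x \<bullet>\<^bsub>N\<^esub> r \<oplus>\<^bsub>N\<^esub> x \<bullet>\<^bsub>N\<^esub> s"
      "x \<bullet>\<^bsub>N\<^esub> (r \<otimes>\<^bsub>R\<^esub> s) = x \<bullet>\<^bsub>N\<^esub> r \<bullet>\<^bsub>N\<^esub> s" if "s \<in> carrier R" for s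
      using a r that by (simp_all add: f M.ract_closed M.ract_add_right M.ract_assoc)
    show "(x \<oplus>\<^bsub>N\<^esub> y) \<bullet>\<^bsub>N\<^esub> r = x \<bullet>\<^bsub>N\<^esub> r \<oplus>\<^bsub>N\<^esub> y \<bullet>\<^bsub>N\<^esub> r" if y: "y \<in> carrier N" for y
      using surj[OF y] a r by (auto simp: f M.ract_closed M.ract_add_left)
  qed
qed

lemma rmod_sum_simps [simp]:
  "carrier (rmod_sum M N) = carrier M \<times> carrier N"
  "p \<oplus>\<^bsub>rmod_sum M N\<^esub> q = (fst p \<oplus>\<^bsub>M\<^esub> fst q, snd p \<oplus>\<^bsub>N\<^esub> snd q)"
  "p \<bullet>\<^bsub>rmod_sum M N\<^esub> r = (fst p \<bullet>\<^bsub>M\<^esub> r, snd p \<bullet>\<^bsub>N\<^esub> r)"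
  by (simp_all add: rmod_sum_def RDirProd_def DirProd_def ring.defs monoid.defs split: prod.splits)

lemma rsubmodule_image:
  assumes "right_module R M" "right_module R N" "f \<in> rmod_hom R M N"
  shows "rsubmodule R N (f ` carrier M)"
proof -
  interpret M: right_module R M by fact
  interpret N: right_module R N by fact
  have "group_hom (add_monoid M) (add_monoid N) f"
    using assms(3) by (simp add: group_hom_def group_hom_axioms_def M.M.a_group N.M.a_group rmod_hom_def)
  then have "additive_subgroup (f ` carrier M) N"
    using group_hom.img_is_subgroup[of "add_monoid M" "add_monoid N" f] by (simp add: additive_subgroup_def)
  moreover have "f x \<bullet>\<^bsub>N\<^esub> r \<in> f ` carrier M" if "x \<in> carrier M" "r \<in> carrier R" for x r
    using that by (intro image_eqI[of _ _ "x \<bullet>\<^bsub>M\<^esub> r"])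
      (simp_all add: rmod_hom_ract[OF assms(3)] M.ract_closed)
  ultimately show ?thesis by (auto simp: rsubmodule_def)
qed

lemma fin_gen_regular:
  assumes "ring R" shows "fin_gen R (regular R)"
proof -
  interpret M: right_module R "regular R" by (rule right_module_regular[OF assms])
  have "carrier R \<subseteq> N" if "rsubmodule R (regular R) N" "\<one>\<^bsub>R\<^esub> \<in> N" for N
  proof
    fix r assume "r \<in> carrier R"
    then have "\<one>\<^bsub>R\<^esub> \<bullet>\<^bsub>regular R\<^esub> r \<in> N" "\<one>\<^bsub>R\<^esub> \<bullet>\<^bsub>regular R\<^esub> r = r"
      using that by (simp_all add: rsubmodule_def del: regular_simps) simp
    then show "r \<in> N" by simp
  qed
  moreover have "rsubmodule R (regular R) (carrier R)"
    using rsubmodule_image[OF M.right_module_axioms M.right_module_axioms, of "\<lambda>x. x"]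
    by (simp add: rmod_hom_def hom_def)
  ultimately have "rspan R (regular R) {\<one>\<^bsub>R\<^esub>} = carrier R"
    unfolding rspan_def by (intro equalityI Inter_lower Inter_greatest) auto
  then show ?thesis unfolding fin_gen_def by (intro exI[of _ "{\<one>\<^bsub>R\<^esub>}"]) simp
qed

text \<open>Z is, up to isomorphism, a direct sum of copies of Y, enlarged by one summand for each
  element of A. Y replaces the regular module, which lives on its own type and so need not be an
  object of the class.\<close>

lemma additive_subcategory_covers_finite_set:
  assumes add: "additive_subcategory R \<X>" and Y: "Y \<in> \<X>"
    and p: "p \<in> rmod_hom R Y (regular R)" "p ` carrier Y = carrier R"
    and N: "right_module R N" and A: "finite A" "A \<subseteq> carrier N"
  shows "\<exists>Z\<in>\<X>. \<exists>g\<in>rmod_hom R Z N. A \<subseteq> g ` carrier Z"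
  using A
proof (induction A)
  case empty
  interpret N: right_module R N by fact
  have "(\<lambda>_. \<zero>\<^bsub>N\<^esub>) \<in> rmod_hom R Y N" by (rule rmod_homI) (simp_all add: N.zero_ract)
  then show ?case using Y by blast
next
  case (insert a A)
  interpret N: right_module R N by fact
  have mod: "right_module R Z" if "Z \<in> \<X>" for Z
    using that add by (auto simp: additive_subcategory_def fmod_def)
  interpret Y: right_module R Y by (rule mod[OF Y])
  obtain Z g where Z: "Z \<in> \<X>" and g: "g \<in> rmod_hom R Z N" "A \<subseteq> g ` carrier Z"
    using insert by auto
  interpret Z: right_module R Z by (rule mod[OF Z])
  note [simp] = rmod_hom_closed[OF g(1)] rmod_hom_add[OF g(1)] rmod_hom_ract[OF g(1)] N.ract_closed
  have "a \<in> carrier N" using insert by simp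
  \<comment> \<open>The composite of p with the map r |-> a r from the regular module to N; it hits
    a wherever p takes the value 1.\<close>
  moreover define q where "q y = a \<bullet>\<^bsub>N\<^esub> p y" for y
  ultimately have q: "q \<in> rmod_hom R Y N"
    using rmod_hom_closed[OF p(1)] rmod_hom_add[OF p(1)] rmod_hom_ract[OF p(1)]
    by (intro rmod_homI) (simp_all add: N.ract_add_right N.ract_assoc)
  note [simp] = rmod_hom_closed[OF q] rmod_hom_add[OF q] rmod_hom_ract[OF q]
  \<comment> \<open>The direct sum lives on a product type, so an isomorphic copy W inside the class
    takes its place.\<close>
  obtain W k where W: "W \<in> \<X>" and k: "k \<in> rmod_hom R W (rmod_sum Z Y)"
    and bij: "bij_betw k (carrier W) (carrier Z \<times> carrier Y)"
    using add Z Y unfolding additive_subcategory_def belongs_to_def rmod_isomorphic_def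
    by (metis rmod_sum_simps(1))
  have gq: "(\<lambda>z. g (fst z) \<oplus>\<^bsub>N\<^esub> q (snd z)) \<in> rmod_hom R (rmod_sum Z Y) N"
    by (rule rmod_homI) (auto simp: N.M.a_ac N.ract_add_left)
  have im: "g z \<oplus>\<^bsub>N\<^esub> q y \<in> (\<lambda>w. g (fst (k w)) \<oplus>\<^bsub>N\<^esub> q (snd (k w))) ` carrier W"
    if zy: "z \<in> carrier Z" "y \<in> carrier Y" for z y
  proof -
    have "(z, y) \<in> k ` carrier W" using zy bij by (simp add: bij_betw_def)
    then obtain w where "w \<in> carrier W" "k w = (z, y)" by (metis imageE)
    then show ?thesis by (intro image_eqI[of _ _ w]) simp_all
  qed
  have "g z \<in> (\<lambda>w. g (fst (k w)) \<oplus>\<^bsub>N\<^esub> q (snd (k w))) ` carrier W" if "z \<in> carrier Z" for z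
    using im[OF that Y.M.zero_closed] that
    by (simp add: rmod_hom_zero[OF Y.right_module_axioms N q])
  moreover obtain y where y: "y \<in> carrier Y" "p y = \<one>\<^bsub>R\<^esub>" using p(2) by (metis N.R.one_closed imageE)
  then have "a \<in> (\<lambda>w. g (fst (k w)) \<oplus>\<^bsub>N\<^esub> q (snd (k w))) ` carrier W"
    using im[OF Z.M.zero_closed y(1)] \<open>a \<in> carrier N\<close>
    by (simp add: rmod_hom_zero[OF Z.right_module_axioms N g(1)] q_def N.ract_one)
  ultimately have "insert a A \<subseteq> (\<lambda>w. g (fst (k w)) \<oplus>\<^bsub>N\<^esub> q (snd (k w))) ` carrier W" using g(2) by blast
  then show ?case by (intro bexI[OF _ W] bexI[OF _ rmod_hom_compose[OF k gq]])
qed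

text \<open>The image of a map that hits a finite generating set of N is a submodule containing
  generators, hence all of N. So N is a quotient of an object of the class.\<close>

lemma torsion_class_eq_fmod:
  fixes \<X> :: "('r, 'u) rmodule set"
  assumes "torsion_class R \<X>" "Y \<in> \<X>" "p \<in> rmod_hom R Y (regular R)" "p ` carrier Y = carrier R"
  shows "\<X> = fmod R"
proof
  have add: "additive_subcategory R \<X>" using assms(1) by (simp add: torsion_class_def)
  then show sub: "\<X> \<subseteq> fmod R" by (simp add: additive_subcategory_def)
  show "fmod R \<subseteq> \<X>"
  proof
    fix N :: "('r, 'u) rmodule" assume N: "N \<in> fmod R"
    then obtain A where A: "finite A" "A \<subseteq> carrier N" "rspan R N A = carrier N"
      and mod: "right_module R N" by (auto simp: fmod_def fin_gen_def)
    obtain Z g where Z: "Z \<in> \<X>" and g: "g \<in> rmod_hom R Z N" "A \<subseteq> g ` carrier Z"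
      using additive_subcategory_covers_finite_set[OF add assms(2-4) mod A(1,2)] by blast
    have "rsubmodule R N (g ` carrier Z)"
      using rsubmodule_image[OF _ mod g(1)] Z sub by (auto simp: fmod_def)
    then have "carrier N \<subseteq> g ` carrier Z" using A(3) g(2) unfolding rspan_def by blast
    then have "g ` carrier Z = carrier N" using rmod_hom_closed[OF g(1)] by blast
    then show "N \<in> \<X>"
      using assms(1) Z N g(1) unfolding torsion_class_def closed_under_quotients_def by blast
  qed
qed

lemma tensor_torsion_class_covers_regular:
  fixes H :: "('k, 'h) hopf" and \<X> :: "('h, 'u) rmodule set"
  assumes "hopf_algebra K H" and universe: "lists (carrier H) \<lesssim> (UNIV :: 'u set)"
    and "tensor_torsion_class K H \<X>" and X: "X \<in> \<X>" "carrier X \<noteq> {\<zero>\<^bsub>X\<^esub>}"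
  shows "\<exists>Y\<in>\<X>. \<exists>p\<in>rmod_hom H Y (regular H). p ` carrier Y = carrier H"
proof -
  interpret hopf_algebra K H by fact
  have mod: "right_module H Z" if "Z \<in> \<X>" for Z
    using that assms(3)
    by (auto simp: tensor_torsion_class_def torsion_class_def additive_subcategory_def fmod_def)
  interpret X: right_module H X by (rule mod[OF X(1)])
  interpret XK: right_module K "restrict_scalars H X" by (rule right_module_restrict[OF X.right_module_axioms])
  \<comment> \<open>The ideal property speaks only of modules carried by the type of the class, so
    the regular module is replaced by a copy, which \<open>universe\<close> provides.\<close>
  obtain M :: "('h, 'u) rmodule" and i where M: "M \<in> fmod H" and i: "i \<in> rmod_hom H M (regular H)"
    and i_bij: "bij_betw i (carrier M) (carrier H)"
    using fin_gen_copy[OF right_module_regular[OF H.ring_axioms] fin_gen_regular[OF H.ring_axioms] universe]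
    unfolding rmod_isomorphic_def by auto
  interpret M: right_module H M using M by (simp add: fmod_def)
  obtain e where e: "e \<in> carrier M" "i e = \<one>\<^bsub>H\<^esub>"
    using i_bij H.one_closed unfolding bij_betw_def by (metis imageE)
  obtain x0 where x0: "x0 \<in> carrier X" "x0 \<noteq> \<zero>\<^bsub>X\<^esub>" using X(2) X.M.zero_closed by blast
  obtain \<phi> where \<phi>: "\<And>x. x \<in> carrier X \<Longrightarrow> \<phi> x \<in> carrier K"
    "\<And>x y. \<lbrakk>x \<in> carrier X; y \<in> carrier X\<rbrakk> \<Longrightarrow> \<phi> (x \<oplus>\<^bsub>X\<^esub> y) = \<phi> x \<oplus>\<^bsub>K\<^esub> \<phi> y"
    "\<And>x c. \<lbrakk>x \<in> carrier X; c \<in> carrier K\<rbrakk> \<Longrightarrow> \<phi> (x \<bullet>\<^bsub>X\<^esub> unit_map H c) = \<phi> x \<otimes>\<^bsub>K\<^esub> c"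
    "\<phi> x0 = \<one>\<^bsub>K\<^esub>"
    using XK.exists_functional[OF K.field_axioms, unfolded restrict_scalars_simps, OF x0] by blast
  obtain Y k where Y: "Y \<in> \<X>" and k: "k \<in> rmod_hom H Y (tensor_module K H X M)"
    and k_bij: "bij_betw k (carrier Y) (carrier (tensor_module K H X M))"
    using assms(3) X(1) M
    unfolding tensor_torsion_class_def tensor_ideal_def belongs_to_def rmod_isomorphic_def by blast
  interpret T: tensor_pair K "restrict_scalars H X" "restrict_scalars H M"
    by (intro tensor_pair.intro right_module_restrict X.right_module_axioms M.right_module_axioms)
  \<comment> \<open>The additive structure comes from the tensor group, the module axioms from the
    isomorphism k with Y.\<close>
  have "abelian_group (tensor_module K H X M)"
    by (rule abelian_group_eqI[OF T.tensor_abelian_group]) simp_all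
  then have "right_module H (tensor_module K H X M)"
    by (rule right_module_iso[OF mod[OF Y] _ k k_bij])
  then interpret hopf_tensor_free K H X M i e "\<lambda>x. unit_map H (\<phi> x)"
    using i i_bij e \<phi>
    by (intro hopf_tensor_free.intro hopf_tensor_free_axioms.intro hopf_algebra_axioms
        X.right_module_axioms M.right_module_axioms)
      (auto simp: bij_betw_def unit_map_add unit_map_mult)
  have "(\<lambda>y. \<Phi> (k y)) ` carrier Y = \<Phi> ` carrier (tensor_module K H X M)"
    using k_bij unfolding bij_betw_def by (metis image_image)
  also have "\<dots> = carrier H" by (rule \<Phi>_surj[OF x0(1)]) (simp add: \<phi>(4) unit_map_one)
  finally show ?thesis using Y rmod_hom_compose[OF k \<Phi>_rmod_hom] by blast
qed

theorem proposition6p24: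
  fixes K :: "('k, 'x) ring_scheme"
    and H :: "('k, 'h) hopf"
    and \<X> :: "('h, 'u) rmodule set"
  assumes "hopf_algebra K H"
    and "cocommutative K H"
    and "right_noetherian H"
    and universe: "lists (carrier H) \<lesssim> (UNIV :: 'u set)"
    and "tensor_torsion_class K H \<X>"
  shows "(\<X> = zero_subcategory H \<or> \<X> = fmod H) \<and> serre_subcategory H \<X>"
proof
  have tors: "torsion_class H \<X>" using assms(5) by (simp add: tensor_torsion_class_def)
  then have sub: "\<X> \<subseteq> fmod H" and zero: "zero_subcategory H \<subseteq> \<X>"
    by (auto simp: torsion_class_def additive_subcategory_def)
  show dich: "\<X> = zero_subcategory H \<or> \<X> = fmod H"
  proof (cases "\<exists>X\<in>\<X>. carrier X \<noteq> {\<zero>\<^bsub>X\<^esub>}")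
    case True
    then show ?thesis
      using tensor_torsion_class_covers_regular[OF assms(1,4,5)] torsion_class_eq_fmod[OF tors] by blast
  next
    case False
    then show ?thesis using sub zero by (auto simp: zero_subcategory_def)
  qed
  have "closed_under_subobjects H (zero_subcategory H :: ('h, 'u) rmodule set)"
    unfolding closed_under_subobjects_def
  proof (intro ballI impI)
    fix X M :: "('h, 'u) rmodule" and f
    assume X: "X \<in> zero_subcategory H" and M: "M \<in> fmod H" and f: "f \<in> rmod_hom H M X" "inj_on f (carrier M)"
    interpret M: right_module H M using M by (simp add: fmod_def)
    have "f x = f \<zero>\<^bsub>M\<^esub>" if "x \<in> carrier M" for x
      using X rmod_hom_closed[OF f(1) that] rmod_hom_closed[OF f(1) M.M.zero_closed]
      by (simp add: zero_subcategory_def)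
    then have "x = \<zero>\<^bsub>M\<^esub>" if "x \<in> carrier M" for x
      using inj_onD[OF f(2) _ that M.M.zero_closed] that by blast
    then have "carrier M = {\<zero>\<^bsub>M\<^esub>}" by auto
    then show "M \<in> zero_subcategory H" using M by (simp add: zero_subcategory_def)
  qed
  \<comment> \<open>By definition the subobjects tested are themselves objects of
    \<open>fmod H\<close>.\<close>
  moreover have "closed_under_subobjects H (fmod H :: ('h, 'u) rmodule set)"
    by (simp add: closed_under_subobjects_def)
  ultimately show "serre_subcategory H \<X>"
    using tors dich by (auto simp: serre_subcategory_def torsion_class_def)
qed

end
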